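(* Let $\mu\in(0,1)$ and let $W$ be the phase space of the restricted planar circular three-body problem in rotating McGehee coordinates $(x,\varphi,P_r,P_\varphi)$, with the line at infinity $\{x=0\}$ included, equipped with the $b^3$-symplectic form $\omega=-\frac{4}{x^3}\,dx\wedge dP_r+d\varphi\wedge dP_\varphi$ with critical set $\{x=0\}$, the Hamiltonian $H$, and the Liouville vector field $Y=p\frac{\partial}{\partial p}=P_r\frac{\partial}{\partial P_r}+P_\varphi\frac{\partial}{\partial P_\varphi}$ (see the context). For $c\in\mathbb{R}$ let $\Sigma_c=H^{-1}(c)\subset W$. Then $Y$ is a $b^3$-vector field which, for every $c>0$, is everywhere transverse to $\Sigma_c$ (including at the points of $\{x=0\}$), and for every $c>0$ the level-set $(\Sigma_c,\iota_Y\omega)$ is a $b^3$-contact manifold. Topologically, its critical set $\Sigma_c\cap\{x=0\}$ is a cylinder, and the Reeb vector field of $\iota_Y\omega|_{\Sigma_c}$ admits infinitely many non-trivial periodic orbits on the critical set.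
   Context: Restricted planar circular three-body problem (RPC3BP) in rotating coordinates: the two primaries, of masses $1-\mu$ and $\mu$, are fixed at $q_E=(\mu,0)$ and $q_M=(-(1-\mu),0)$. The massless body has position $q=(q_1,q_2)\in\mathbb{R}^2\setminus\{q_E,q_M\}$ and momentum $p=(p_1,p_2)\in\mathbb{R}^2$, and the Hamiltonian is $$H(q,p)=\frac{|p|^2}{2}-\frac{1-\mu}{|q-q_E|}-\frac{\mu}{|q-q_M|}+p_1q_2-p_2q_1 .$$ Symplectic polar coordinates $(r,\varphi,P_r,P_\varphi)$ are given by $q=(r\cos\varphi,r\sin\varphi)$, $p=(P_r\cos\varphi-\frac{P_\varphi}{r}\sin\varphi,\;P_r\sin\varphi+\frac{P_\varphi}{r}\cos\varphi)$. The McGehee change of coordinates is $r=\frac{2}{x^2}$, $x>0$. The symplectic form $dr\wedge dP_r+d\varphi\wedge dP_\varphi$ becomes $\omega=-\frac{4}{x^3}dx\wedge dP_r+d\varphi\wedge dP_\varphi$. In these coordinates, with $q=\frac{2}{x^2}(\cos\varphi,\sin\varphi)$, $$H=\tfrac12\left(P_r^2+\tfrac14x^4P_\varphi^2\right)-\frac{1-\mu}{|q-q_E|}-\frac{\mu}{|q-q_M|}-P_\varphi ,$$ and this extends smoothly to $x=0$, where $H=\frac12P_r^2-P_\varphi$. The phase space $W$ is the set of $(x,\varphi,P_r,P_\varphi)\in[0,\infty)\times S^1\times\mathbb{R}^2$ such that, if $x>0$, the position $q$ is different from $q_E$ and $q_M$. It is a manifold with boundary $\{x=0\}$ (the manifold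 at infinity), and the boundary is the critical hypersurface. $b^m$-geometry: let $N$ be a manifold with a hypersurface $Z$ (possibly its boundary) with defining function $x$, i.e. $Z=x^{-1}(0)$ and $dx\neq0$ along $Z$. A $b^m$-vector field is a smooth vector field $v$ with $v(x)\in x^mC^\infty(N)$. These are the sections of a vector bundle ${}^{b^m}TN$ (locally spanned by $x^m\partial_x$ and the coordinate vector fields along $Z$). A $b^m$-form of degree $k$ is a section of $\Lambda^k({}^{b^m}TN)^*$, equivalently a form $\frac{dx}{x^m}\wedge\eta+\beta$ with $\eta,\beta$ smooth forms. The exterior derivative is the extension of the usual one on $N\setminus Z$. A $b^m$-symplectic form on an even-dimensional $N^{2n}$ is a closed $b^m$-form $\omega$ of degree 2 with $\omega^n\ne0$ as a section of $\Lambda^{2n}({}^{b^m}TN)^*$. A $b^m$-contact form on $N^{2n+1}$ is a $b^m$-form $\lambda$ of degree 1 with $\lambda\wedge(d\lambda)^n\neq0$ everywhere as a section of $\Lambda^{2n+1}({}^{b^m}TN)^*$. Its Reeb vector field is the unique $b^m$-vector field $R$ with $\iota_Rd\lambda=0$, $\lambda(R)=1$; as a smooth vector field it is tangent to $Z$. A Liouville vector field is a vector field $Y$ with $\mathcal{L}_Y\omega=\omega$. A periodic orbit is non-trivial if it is not a constant orbit. *)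

theory Defs
  imports "HOL-Analysis.Analysis"
begin

section \<open>Smooth maps on subsets of Euclidean spaces\<close>

primrec Ck_on :: "nat \<Rightarrow> 'a::euclidean_space set \<Rightarrow> ('a \<Rightarrow> 'b::real_normed_vector) \<Rightarrow> bool" where
  "Ck_on 0 U f \<longleftrightarrow> continuous_on U f"
| "Ck_on (Suc k) U f \<longleftrightarrow> (\<forall>p\<in>U. f differentiable (at p)) \<and>
     (\<forall>v. Ck_on k U (\<lambda>p. frechet_derivative f (at p) v))"

text \<open>To be used for open \<open>U\<close> only.\<close>

definition Cinf_on :: "'a::euclidean_space set \<Rightarrow> ('a \<Rightarrow> 'b::real_normed_vector) \<Rightarrow> bool" where
  "Cinf_on U f \<longleftrightarrow> (\<forall>k. Ck_on k U f)"

text \<open>On an arbitrary subset, smooth means: locally the restriction of a smooth map on an open set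
  of the ambient space.\<close>

definition smooth_on :: "'a::euclidean_space set \<Rightarrow> ('a \<Rightarrow> 'b::real_normed_vector) \<Rightarrow> bool" where
  "smooth_on A f \<longleftrightarrow>
     (\<forall>p\<in>A. \<exists>U g. open U \<and> p \<in> U \<and> Cinf_on U g \<and> (\<forall>q\<in>U \<inter> A. g q = f q))"


section \<open>Manifolds with boundary\<close>

text \<open>Manifolds are embedded in a Euclidean space: \<open>N\<close> is a \<open>d\<close>-dimensional smooth manifold with
  boundary exactly \<open>B\<close> if it is locally diffeomorphic to relatively open subsets of a
  \<open>d\<close>-dimensional half space \<open>{y \<in> S. 0 \<le> y \<bullet> e}\<close>, where \<open>S\<close> is a \<open>d\<close>-dimensional linear subspace,
  with \<open>B\<close> corresponding to the bounding hyperplane \<open>y \<bullet> e = 0\<close>.\<close>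

definition manifold_with_boundary :: "nat \<Rightarrow> 'a::euclidean_space set \<Rightarrow> 'a set \<Rightarrow> bool" where
  "manifold_with_boundary d N B \<longleftrightarrow> B \<subseteq> N \<and>
     (\<forall>p\<in>N. \<exists>(S :: 'a set) e \<Omega> (f :: 'a \<Rightarrow> 'a) (g :: 'a \<Rightarrow> 'a).
        subspace S \<and> dim S = d \<and> e \<in> S \<and> e \<noteq> 0 \<and>
        openin (top_of_set {y \<in> S. 0 \<le> y \<bullet> e}) \<Omega> \<and>
        p \<in> f ` \<Omega> \<and> openin (top_of_set N) (f ` \<Omega>) \<and>
        smooth_on \<Omega> f \<and> smooth_on (f ` \<Omega>) g \<and> (\<forall>y\<in>\<Omega>. g (f y) = y) \<and>
        (\<forall>y\<in>\<Omega>. f y \<in> B \<longleftrightarrow> y \<bullet> e = 0))"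

text \<open>The tangent space consists of the velocities of curves; at a boundary point the one-sided
  velocities of curves in \<open>N\<close> only fill a half space, hence the span.\<close>

definition tangent_space :: "'a::euclidean_space set \<Rightarrow> 'a \<Rightarrow> 'a set" where
  "tangent_space N p = span {v. \<exists>\<gamma> \<epsilon>. 0 < \<epsilon> \<and> \<gamma> 0 = p \<and> (\<forall>t\<in>{0..<\<epsilon>}. \<gamma> t \<in> N) \<and>
      (\<gamma> has_vector_derivative v) (at 0 within {0..<\<epsilon>})}"

text \<open>Transversality to a hypersurface \<open>S\<close> of \<open>N\<close>, i.e. \<open>T\<^sub>pN = T\<^sub>pS \<oplus> \<real> Y\<^sub>p\<close>.\<close>

definition transverse_to :: "'a::euclidean_space set \<Rightarrow> 'a set \<Rightarrow> ('a \<Rightarrow> 'a) \<Rightarrow> bool" where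
  "transverse_to N S Y \<longleftrightarrow>
     (\<forall>p\<in>S. Y p \<notin> tangent_space S p \<and>
            span (insert (Y p) (tangent_space S p)) = tangent_space N p)"


section \<open>Differential forms\<close>

text \<open>A \<open>k\<close>-form takes the vectors \<open>v 0, \<dots>, v (k - 1)\<close> at a point. A form on an embedded manifold is
  represented by a form on a neighbourhood of it in the ambient space; it is only ever evaluated on
  vectors tangent to the manifold. Since the exterior derivative commutes with restriction, it may
  be computed on the representative.\<close>

type_synonym 'a dform = "'a \<Rightarrow> (nat \<Rightarrow> 'a) \<Rightarrow> real"

definition alternating :: "nat \<Rightarrow> ((nat \<Rightarrow> 'a::real_vector) \<Rightarrow> real) \<Rightarrow> bool" where
  "alternating k \<alpha> \<longleftrightarrow>
     (\<forall>v w. (\<forall>i<k. v i = w i) \<longrightarrow> \<alpha> v = \<alpha> w) \<and>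
     (\<forall>v. \<forall>i<k. linear (\<lambda>u. \<alpha> (v(i := u)))) \<and>
     (\<forall>v i j. i < j \<and> j < k \<and> v i = v j \<longrightarrow> \<alpha> v = 0)"

definition smooth_form :: "'a::euclidean_space set \<Rightarrow> nat \<Rightarrow> 'a dform \<Rightarrow> bool" where
  "smooth_form U k \<alpha> \<longleftrightarrow> (\<forall>p\<in>U. alternating k (\<alpha> p)) \<and> (\<forall>v. Cinf_on U (\<lambda>p. \<alpha> p v))"

text \<open>Wedge product of a \<open>k\<close>-form and an \<open>l\<close>-form.\<close>

definition wedge :: "nat \<Rightarrow> nat \<Rightarrow> 'a dform \<Rightarrow> 'a dform \<Rightarrow> 'a dform" where
  "wedge k l \<alpha> \<beta> = (\<lambda>p v. (\<Sum>\<sigma> | \<sigma> permutes {..<k + l}.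
      of_int (sign \<sigma>) * \<alpha> p (\<lambda>i. v (\<sigma> i)) * \<beta> p (\<lambda>i. v (\<sigma> (k + i)))) / (fact k * fact l))"

text \<open>The \<open>n\<close>-th wedge power of a 2-form.\<close>

primrec wedge_power :: "'a dform \<Rightarrow> nat \<Rightarrow> 'a dform" where
  "wedge_power \<omega> 0 = (\<lambda>p v. 1)"
| "wedge_power \<omega> (Suc n) = wedge 2 (2 * n) \<omega> (wedge_power \<omega> n)"

definition differential :: "('a::euclidean_space \<Rightarrow> real) \<Rightarrow> 'a dform" where
  "differential f = (\<lambda>p v. frechet_derivative f (at p) (v 0))"

text \<open>Exterior derivative of a \<open>k\<close>-form: the usual alternating sum, for constant vector fields.\<close>

definition ext_deriv :: "nat \<Rightarrow> 'a::euclidean_space dform \<Rightarrow> 'a dform" where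
  "ext_deriv k \<alpha> = (\<lambda>p v. \<Sum>i\<le>k. (-1) ^ i *
      frechet_derivative (\<lambda>q. \<alpha> q (\<lambda>j. v (if j < i then j else Suc j))) (at p) (v i))"

definition contract :: "('a \<Rightarrow> 'a) \<Rightarrow> 'a dform \<Rightarrow> 'a dform" where
  "contract Y \<alpha> = (\<lambda>p v. \<alpha> p (case_nat (Y p) v))"

text \<open>Lie derivative of a \<open>k\<close>-form along \<open>Y\<close>, in the linear coordinates of the ambient space.\<close>

definition lie_deriv :: "nat \<Rightarrow> ('a::euclidean_space \<Rightarrow> 'a) \<Rightarrow> 'a dform \<Rightarrow> 'a dform" where
  "lie_deriv k Y \<alpha> = (\<lambda>p v. frechet_derivative (\<lambda>q. \<alpha> q v) (at p) (Y p) +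
      (\<Sum>i<k. \<alpha> p (v(i := frechet_derivative Y (at p) (v i)))))"


section \<open>Geometry of \<open>b\<^sup>m\<close>-manifolds\<close>

definition crit_set :: "'a set \<Rightarrow> ('a \<Rightarrow> real) \<Rightarrow> 'a set" where
  "crit_set N x = {p \<in> N. x p = 0}"

text \<open>A \<open>d\<close>-manifold \<open>N\<close> with critical hypersurface \<open>crit_set N x\<close> and defining function \<open>x\<close>. The
  boundary \<open>B\<close> of \<open>N\<close> (which may be empty) is required to lie in the critical hypersurface.\<close>

definition bm_manifold ::
  "nat \<Rightarrow> 'a::euclidean_space set \<Rightarrow> 'a set \<Rightarrow> ('a \<Rightarrow> real) \<Rightarrow> bool" where
  "bm_manifold d N B x \<longleftrightarrow> manifold_with_boundary d N B \<and> B \<subseteq> crit_set N x \<and>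
     (\<exists>U. open U \<and> N \<subseteq> U \<and> Cinf_on U x) \<and>
     (\<forall>p\<in>crit_set N x. \<exists>v\<in>tangent_space N p. frechet_derivative x (at p) v \<noteq> 0)"

definition bm_vector_field ::
  "nat \<Rightarrow> 'a::euclidean_space set \<Rightarrow> ('a \<Rightarrow> real) \<Rightarrow> ('a \<Rightarrow> 'a) \<Rightarrow> bool" where
  "bm_vector_field m N x V \<longleftrightarrow> smooth_on N V \<and> (\<forall>p\<in>N. V p \<in> tangent_space N p) \<and>
     (\<exists>g. smooth_on N g \<and> (\<forall>p\<in>N. frechet_derivative x (at p) (V p) = x p ^ m * g p))"

text \<open>A \<open>b\<^sup>m\<close>-form \<open>dx / x\<^sup>m \<and> \<eta> + \<beta>\<close> is represented by its values off the critical hypersurface,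
  which determine it; its values at \<open>x = 0\<close> are irrelevant. Identities between \<open>b\<^sup>m\<close>-forms are
  accordingly tested off the critical hypersurface, whose complement is dense.\<close>

definition bm_form ::
  "nat \<Rightarrow> 'a::euclidean_space set \<Rightarrow> ('a \<Rightarrow> real) \<Rightarrow> nat \<Rightarrow> 'a dform \<Rightarrow> bool" where
  "bm_form m N x k \<omega> \<longleftrightarrow> 1 \<le> k \<and>
     (\<exists>U \<eta> \<beta>. open U \<and> N \<subseteq> U \<and> Cinf_on U x \<and> smooth_form U (k - 1) \<eta> \<and> smooth_form U k \<beta> \<and>
        (\<forall>p\<in>U. x p \<noteq> 0 \<longrightarrow>
           (\<forall>v. \<omega> p v = wedge 1 (k - 1) (differential x) \<eta> p v / x p ^ m + \<beta> p v)))"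

text \<open>A \<open>b\<^sup>m\<close>-form of degree \<open>k\<close> pairs with \<open>k\<close> many \<open>b\<^sup>m\<close>-vector fields to give a smooth function \<open>g\<close>
  on all of \<open>N\<close>. It is nonzero at a point, as a section of the \<open>k\<close>-th exterior power of the dual of
  the \<open>b\<^sup>m\<close>-tangent bundle, iff some such pairing is nonzero there. At the critical hypersurface this
  is not the nonvanishing of a form on the ordinary tangent space.\<close>

definition bm_nonvanishing ::
  "nat \<Rightarrow> 'a::euclidean_space set \<Rightarrow> ('a \<Rightarrow> real) \<Rightarrow> nat \<Rightarrow> 'a dform \<Rightarrow> bool" where
  "bm_nonvanishing m N x k \<omega> \<longleftrightarrow>
     (\<forall>p\<in>N. \<exists>(V :: nat \<Rightarrow> 'a \<Rightarrow> 'a) g. (\<forall>i<k. bm_vector_field m N x (V i)) \<and> smooth_on N g \<and>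
        (\<forall>q\<in>N. x q \<noteq> 0 \<longrightarrow> \<omega> q (\<lambda>i. V i q) = g q) \<and> g p \<noteq> 0)"

definition bm_closed ::
  "'a::euclidean_space set \<Rightarrow> ('a \<Rightarrow> real) \<Rightarrow> nat \<Rightarrow> 'a dform \<Rightarrow> bool" where
  "bm_closed N x k \<omega> \<longleftrightarrow>
     (\<forall>p\<in>N - crit_set N x. \<forall>v. (\<forall>i\<le>k. v i \<in> tangent_space N p) \<longrightarrow> ext_deriv k \<omega> p v = 0)"

definition bm_symplectic ::
  "nat \<Rightarrow> nat \<Rightarrow> 'a::euclidean_space set \<Rightarrow> 'a set \<Rightarrow> ('a \<Rightarrow> real) \<Rightarrow> 'a dform \<Rightarrow> bool" where
  "bm_symplectic m n N B x \<omega> \<longleftrightarrow> bm_manifold (2 * n) N B x \<and> bm_form m N x 2 \<omega> \<and>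
     bm_closed N x 2 \<omega> \<and> bm_nonvanishing m N x (2 * n) (wedge_power \<omega> n)"

definition bm_contact ::
  "nat \<Rightarrow> nat \<Rightarrow> 'a::euclidean_space set \<Rightarrow> 'a set \<Rightarrow> ('a \<Rightarrow> real) \<Rightarrow> 'a dform \<Rightarrow> bool" where
  "bm_contact m n N B x \<alpha> \<longleftrightarrow> bm_manifold (2 * n + 1) N B x \<and> bm_form m N x 1 \<alpha> \<and>
     bm_nonvanishing m N x (2 * n + 1) (wedge 1 (2 * n) \<alpha> (wedge_power (ext_deriv 1 \<alpha>) n))"

definition reeb_field ::
  "nat \<Rightarrow> 'a::euclidean_space set \<Rightarrow> ('a \<Rightarrow> real) \<Rightarrow> 'a dform \<Rightarrow> ('a \<Rightarrow> 'a) \<Rightarrow> bool" where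
  "reeb_field m N x \<alpha> R \<longleftrightarrow> bm_vector_field m N x R \<and>
     (\<forall>p\<in>N - crit_set N x. \<alpha> p (\<lambda>_. R p) = 1 \<and>
        (\<forall>v. v 0 \<in> tangent_space N p \<longrightarrow> contract R (ext_deriv 1 \<alpha>) p v = 0))"

definition liouville_field ::
  "'a::euclidean_space set \<Rightarrow> ('a \<Rightarrow> real) \<Rightarrow> 'a dform \<Rightarrow> ('a \<Rightarrow> 'a) \<Rightarrow> bool" where
  "liouville_field N x \<omega> Y \<longleftrightarrow> (\<exists>U. open U \<and> N \<subseteq> U \<and> Cinf_on U Y) \<and>
     (\<forall>p\<in>N. Y p \<in> tangent_space N p) \<and>
     (\<forall>p\<in>N - crit_set N x. \<forall>v. (\<forall>i<2. v i \<in> tangent_space N p) \<longrightarrow>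
        lie_deriv 2 Y \<omega> p v = \<omega> p v)"

text \<open>Orbits are taken as subsets, so that reparametrisations are not counted twice.\<close>

definition nontrivial_periodic_orbit ::
  "('a::real_normed_vector \<Rightarrow> 'a) \<Rightarrow> 'a set \<Rightarrow> bool" where
  "nontrivial_periodic_orbit R C \<longleftrightarrow>
     (\<exists>\<gamma> T. (\<forall>t::real. (\<gamma> has_vector_derivative R (\<gamma> t)) (at t)) \<and>
        0 < T \<and> (\<forall>t. \<gamma> (t + T) = \<gamma> t) \<and> (\<exists>t. \<gamma> t \<noteq> \<gamma> 0) \<and> C = range \<gamma>)"


section \<open>The restricted three-body problem in McGehee coordinates\<close>

text \<open>The angle \<open>\<phi> \<in> S\<^sup>1\<close> is represented by the unit complex number \<open>z = cis \<phi>\<close>, and the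
  plane of positions is identified with the complex numbers, so that \<open>q = (2 / x\<^sup>2) z\<close>. A point is
  \<open>(x, z, P\<^sub>r, P\<^sub>\<phi>)\<close>; forms and vector fields live near \<open>cmod z = 1\<close> in the ambient space.\<close>

type_synonym mcgehee = "real \<times> complex \<times> real \<times> real"

definition mx :: "mcgehee \<Rightarrow> real" where "mx = (\<lambda>(x, z, Pr, P\<phi>). x)"
definition mPr :: "mcgehee \<Rightarrow> real" where "mPr = (\<lambda>(x, z, Pr, P\<phi>). Pr)"
definition mP\<phi> :: "mcgehee \<Rightarrow> real" where "mP\<phi> = (\<lambda>(x, z, Pr, P\<phi>). P\<phi>)"

definition q_pos :: "mcgehee \<Rightarrow> complex" where
  "q_pos = (\<lambda>(x, z, Pr, P\<phi>). of_real (2 / x\<^sup>2) * z)"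

definition q_E :: "real \<Rightarrow> complex" where "q_E \<mu> = of_real \<mu>"
definition q_M :: "real \<Rightarrow> complex" where "q_M \<mu> = of_real (- (1 - \<mu>))"

definition phase_space :: "real \<Rightarrow> mcgehee set" where
  "phase_space \<mu> = {(x, z, Pr, P\<phi>). 0 \<le> x \<and> cmod z = 1 \<and>
     (0 < x \<longrightarrow> q_pos (x, z, Pr, P\<phi>) \<noteq> q_E \<mu> \<and> q_pos (x, z, Pr, P\<phi>) \<noteq> q_M \<mu>)}"

text \<open>The case distinction is needed since \<open>2 / 0 = 0\<close>; the value at \<open>x = 0\<close> is the smooth extension.\<close>

definition hamiltonian :: "real \<Rightarrow> mcgehee \<Rightarrow> real" where
  "hamiltonian \<mu> = (\<lambda>(x, z, Pr, P\<phi>).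
     if x = 0 then Pr\<^sup>2 / 2 - P\<phi>
     else (Pr\<^sup>2 + x ^ 4 * P\<phi>\<^sup>2 / 4) / 2
          - (1 - \<mu>) / cmod (q_pos (x, z, Pr, P\<phi>) - q_E \<mu>)
          - \<mu> / cmod (q_pos (x, z, Pr, P\<phi>) - q_M \<mu>) - P\<phi>)"

definition energy_level :: "real \<Rightarrow> real \<Rightarrow> mcgehee set" where
  "energy_level \<mu> c = {s \<in> phase_space \<mu>. hamiltonian \<mu> s = c}"

text \<open>The closed angular form \<open>d\<phi> = Im (dz / z)\<close>.\<close>

definition d\<phi> :: "mcgehee dform" where
  "d\<phi> = (\<lambda>(x, z, Pr, P\<phi>) v. Im (fst (snd (v 0)) / z))"

definition symp_form :: "mcgehee dform" where
  "symp_form = (\<lambda>s v. - (4 / mx s ^ 3) * wedge 1 1 (differential mx) (differential mPr) s v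
     + wedge 1 1 d\<phi> (differential mP\<phi>) s v)"

definition Y_field :: "mcgehee \<Rightarrow> mcgehee" where
  "Y_field = (\<lambda>(x, z, Pr, P\<phi>). (0, 0, Pr, P\<phi>))"

end

theory Submission
  imports Defs
begin

text \<open>
  In McGehee coordinates each distance to a primary equals \<open>\<bar>2 z - a x\<^sup>2\<bar> / x\<^sup>2\<close> with \<open>a = \<mu>\<close> or \<open>a
  = - (1 - \<mu>)\<close>. Hence the Hamiltonian is \<open>H = kinetic - P\<^sub>\<phi> - pot\<close>, where \<open>kinetic\<close> is quadratic in
  the momenta and \<open>pot \<ge> 0\<close> is \<open>x\<^sup>2\<close> times a function that is smooth across \<open>x = 0\<close>. The whole
  theorem rests on the identity \<open>Y H = 2 kinetic - P\<^sub>\<phi> = kinetic + pot + H\<close>, which shows that \<open>Y H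
  > 0\<close> on every level \<open>H = c > 0\<close>, including its part at infinity (\<open>YH_pos\<close>).

  Along a ray of momenta, that is along \<open>Y\<close>, the equation \<open>H = c\<close> is quadratic with negative
  constant term \<open>- (pot + c)\<close>. It has exactly one positive root if \<open>kinetic > 0\<close> or \<open>P\<^sub>\<phi> < 0\<close>, and
  this root is a smooth function even where the leading coefficient vanishes. This gives a smooth
  projection \<open>level_proj\<close> of a conical open set onto the level. It turns products of charts for
  the position angle and for the direction of the momentum into charts of the level
  (\<open>manifold_energy_level\<close>), and curves of the phase space into curves of the level, so that the
  tangent space of the level is the kernel of \<open>dH\<close> (\<open>tangent_space_energy_level\<close>). Transversality
  of \<open>Y\<close> then is \<open>Y H \<noteq> 0\<close>.

  The form \<open>\<lambda> = \<iota>\<^sub>Y \<omega>\<close> satisfies \<open>d\<lambda> = \<omega>\<close>, hence \<open>\<lambda> \<and> d\<lambda>\<close> is half of \<open>\<iota>\<^sub>Y (\<omega> \<and> \<omega>)\<close> and does not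
  change when its arguments are projected along \<open>Y\<close> to the level. Its value on the projections of
  \<open>x\<^sup>3 \<partial>\<^sub>x\<close>, \<open>\<partial>\<^sub>\<phi>\<close> and \<open>P\<^sub>\<phi> \<partial>\<^sub>r - P\<^sub>r \<partial>\<^sub>P\<close> is \<open>- 4 (P\<^sub>r\<^sup>2 + P\<^sub>\<phi>\<^sup>2)\<close>, and the momentum cannot vanish where \<open>Y
  H > 0\<close> (\<open>bm_contact_energy_level\<close>).

  Let \<open>X\<close> be given by \<open>\<omega>(X, \<cdot>) = dH\<close>. The Reeb field is \<open>- X / Y H\<close>. Off the critical set any Reeb
  field agrees with it by nondegeneracy of \<open>\<omega>\<close>, and by continuity it does so at infinity, because
  every point at infinity is a limit of points of the level with \<open>x > 0\<close>. The potential vanishes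
  to second order at \<open>x = 0\<close>, so there the Reeb field is \<open>\<partial>\<^sub>\<phi> / Y H\<close> (\<open>reeb_field_at_infinity\<close>).
  The critical set is the cylinder \<open>P\<^sub>\<phi> = P\<^sub>r\<^sup>2 / 2 - c\<close> over the coordinates \<open>(z, P\<^sub>r)\<close>, and its
  circles of constant \<open>P\<^sub>r\<close> are the desired periodic orbits.
\<close>

section \<open>Calculus of smooth maps\<close>

lemma Ck_on_cong:
  assumes "open U" "\<And>p. p \<in> U \<Longrightarrow> f p = g p"
  shows "Ck_on k U f \<longleftrightarrow> Ck_on k U g"
  using assms(2)
proof (induction k arbitrary: f g)
  case 0
  then show ?case using continuous_on_cong by auto
next
  case (Suc k)
  have tr: "(g has_derivative D) (at p)" if "(f has_derivative D) (at p)" "p \<in> U"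
      "\<And>p. p \<in> U \<Longrightarrow> f p = g p" for f g D p
    using has_derivative_transform_within_open[OF that(1) assms(1) that(2)] that(3) by blast
  have d: "f differentiable (at p) \<longleftrightarrow> g differentiable (at p)" if "p \<in> U" for p
    using tr[of f _ p g] tr[of g _ p f] that Suc.prems unfolding differentiable_def by metis
  have e: "frechet_derivative f (at p) = frechet_derivative g (at p)" if "p \<in> U" for p
  proof -
    have "(f has_derivative D) (at p) \<longleftrightarrow> (g has_derivative D) (at p)" for D
      using tr[of f D p g] tr[of g D p f] that Suc.prems by metis
    then show ?thesis unfolding frechet_derivative_def by simp
  qed
  have "Ck_on k U (\<lambda>p. frechet_derivative f (at p) v)
      \<longleftrightarrow> Ck_on k U (\<lambda>p. frechet_derivative g (at p) v)" for v
    by (rule Suc.IH) (simp add: e)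
  then show ?case using d by simp
qed

lemma Ck_on_imp_continuous_on: "Ck_on k U f \<Longrightarrow> continuous_on U f"
  by (cases k) (auto intro!: differentiable_imp_continuous_within continuous_at_imp_continuous_on)

lemma Ck_on_Suc_imp: "Ck_on (Suc k) U f \<Longrightarrow> Ck_on k U f"
proof (induction k arbitrary: f)
  case 0
  then show ?case using Ck_on_imp_continuous_on[of "Suc 0"] by simp
next
  case (Suc k)
  then show ?case by (metis Ck_on.simps(2))
qed

text \<open>The derivative may be given in any form that agrees with it on \<open>U\<close>.\<close>

lemma Ck_on_SucI:
  assumes "open U" "\<And>p. p \<in> U \<Longrightarrow> (f has_derivative D p) (at p)"
    and "\<And>v. Ck_on k U (\<lambda>p. D p v)"
  shows "Ck_on (Suc k) U f"
proof -
  have e: "frechet_derivative f (at p) v = D p v" if "p \<in> U" for p v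
    using frechet_derivative_at[OF assms(2)[OF that]] by simp
  show ?thesis
    using assms Ck_on_cong[OF assms(1) e] by (auto simp: differentiable_def)
qed

lemma Ck_on_SucD:
  assumes "Ck_on (Suc k) U f" "p \<in> U"
  shows "(f has_derivative frechet_derivative f (at p)) (at p)"
  using assms frechet_derivative_works by auto

lemma Ck_on_const: "open U \<Longrightarrow> Ck_on k U (\<lambda>p. c)"
proof (induction k arbitrary: c)
  case (Suc k)
  show ?case
    by (rule Ck_on_SucI[where D = "\<lambda>p v. 0"]) (use Suc in auto)
qed simp

lemma Ck_on_bounded_linear_compose:
  assumes L: "bounded_linear L" and "open U" "Ck_on k U f"
  shows "Ck_on k U (\<lambda>p. L (f p))"
  using assms(3)
proof (induction k arbitrary: f)
  case 0
  then show ?case using L by (auto intro: linear_continuous_on_compose linear_linear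
        bounded_linear.continuous_on)
next
  case (Suc k)
  show ?case
    by (rule Ck_on_SucI[where D = "\<lambda>p v. L (frechet_derivative f (at p) v)"])
      (use Suc assms Ck_on_SucD[OF Suc.prems] in
        \<open>auto intro: bounded_linear.has_derivative[OF L]\<close>)
qed

lemma Ck_on_add:
  assumes "open U" "Ck_on k U f" "Ck_on k U g"
  shows "Ck_on k U (\<lambda>p. f p + g p)"
  using assms(2,3)
proof (induction k arbitrary: f g)
  case (Suc k)
  show ?case
    by (rule Ck_on_SucI[where
          D = "\<lambda>p v. frechet_derivative f (at p) v + frechet_derivative g (at p) v"])
      (use Suc assms(1) Ck_on_SucD[OF Suc.prems(1)] Ck_on_SucD[OF Suc.prems(2)] in
        \<open>auto intro: has_derivative_add\<close>)
qed (auto intro: continuous_on_add)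

lemma Ck_on_bilinear:
  assumes B: "bounded_bilinear B" and "open U" "Ck_on k U f" "Ck_on k U g"
  shows "Ck_on k U (\<lambda>p. B (f p) (g p))"
  using assms(3,4)
proof (induction k arbitrary: f g)
  case 0
  then show ?case using bounded_bilinear.continuous_on[OF B] by auto
next
  case (Suc k)
  note fg = Ck_on_Suc_imp[OF Suc.prems(1)] Ck_on_Suc_imp[OF Suc.prems(2)]
  show ?case
    by (rule Ck_on_SucI[where D = "\<lambda>p v. B (f p) (frechet_derivative g (at p) v)
          + B (frechet_derivative f (at p) v) (g p)"])
      (use Suc assms(2) Ck_on_SucD[OF Suc.prems(1)] Ck_on_SucD[OF Suc.prems(2)] fg in
        \<open>auto intro!: bounded_bilinear.FDERIV[OF B] Ck_on_add\<close>)
qed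

lemma Ck_on_sum:
  assumes "open U" "finite I" "\<And>i. i \<in> I \<Longrightarrow> Ck_on k U (f i)"
  shows "Ck_on k U (\<lambda>p. \<Sum>i\<in>I. f i p)"
  using assms(2,3)
proof (induction I rule: finite_induct)
  case empty
  then show ?case using Ck_on_const[OF assms(1)] by simp
next
  case (insert i I)
  then show ?case by (simp add: Ck_on_add[OF assms(1)])
qed

text \<open>Chain rule: the partial derivatives of \<open>g\<close>, composed with \<open>f\<close>, are covered by the induction
  hypothesis.\<close>

lemma Ck_on_compose:
  fixes f :: "'a::euclidean_space \<Rightarrow> 'b::euclidean_space" and g :: "'b \<Rightarrow> 'c::real_normed_vector"
  assumes "open U" "open V" "f ` U \<subseteq> V" "Ck_on k U f" "Ck_on k V g"
  shows "Ck_on k U (\<lambda>p. g (f p))"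
  using assms(4,5)
proof (induction k arbitrary: g)
  case 0
  then show ?case using assms(3) by (auto intro: continuous_on_compose2)
next
  case (Suc k)
  let ?f' = "\<lambda>p. frechet_derivative f (at p)" and ?g' = "\<lambda>q. frechet_derivative g (at q)"
  have g': "(g has_derivative ?g' (f p)) (at (f p))" if "p \<in> U" for p
    using Ck_on_SucD[OF Suc.prems(2)] assms(3) that by auto
  have expand: "?g' (f p) (?f' p v) = (\<Sum>b\<in>Basis. (?f' p v \<bullet> b) *\<^sub>R ?g' (f p) b)"
    if "p \<in> U" for p v
  proof -
    have "linear (?g' (f p))" using g'[OF that] has_derivative_linear by blast
    from linear_sum[OF this, of "\<lambda>b. (?f' p v \<bullet> b) *\<^sub>R b" Basis] show ?thesis
      by (simp add: euclidean_representation linear_cmul[OF \<open>linear _\<close>])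
  qed
  show ?case
  proof (rule Ck_on_SucI[where D = "\<lambda>p v. \<Sum>b\<in>Basis. (?f' p v \<bullet> b) *\<^sub>R ?g' (f p) b"])
    show "open U" by fact
    show "((\<lambda>p. g (f p)) has_derivative (\<lambda>v. \<Sum>b\<in>Basis. (?f' p v \<bullet> b) *\<^sub>R ?g' (f p) b)) (at p)"
      if "p \<in> U" for p
      using has_derivative_compose[OF Ck_on_SucD[OF Suc.prems(1) that] g'[OF that]]
        expand[OF that] by simp
    show "Ck_on k U (\<lambda>p. \<Sum>b\<in>Basis. (?f' p v \<bullet> b) *\<^sub>R ?g' (f p) b)" for v
    proof (intro Ck_on_sum Ck_on_bilinear[OF bounded_bilinear_scaleR] assms(1) finite_Basis)
      show "Ck_on k U (\<lambda>p. ?f' p v \<bullet> b)" for b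
        using Suc.prems(1)
        by (intro Ck_on_bounded_linear_compose[OF bounded_linear_inner_left] assms(1)) simp
      show "Ck_on k U (\<lambda>p. ?g' (f p) b)" for b
        using Suc.IH[of "\<lambda>q. ?g' q b"] Suc.prems Ck_on_Suc_imp[OF Suc.prems(1)] by simp
    qed
  qed
qed

text \<open>The factor \<open>c\<close> absorbs the constants that differentiation produces, so that the family
  is closed under derivatives.\<close>

lemma Ck_on_powr: "Ck_on k {0<..} (\<lambda>t::real. c * t powr a)"
proof (induction k arbitrary: c a)
  case 0
  show ?case by (auto intro!: continuous_intros)
next
  case (Suc k)
  have "((\<lambda>t. c * t powr a) has_derivative (\<lambda>v. v *\<^sub>R (c * a * p powr (a - 1)))) (at p)"
    if "p > 0" for p :: real
    using that by (auto intro!: derivative_eq_intros simp: field_simps powr_diff)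
  moreover have "Ck_on k {0<..} (\<lambda>p. v *\<^sub>R (c * a * p powr (a - 1)))" for v :: real
    using Ck_on_bounded_linear_compose[OF bounded_linear_scaleR_right _ Suc.IH, of v] by simp
  ultimately show ?case
    by (intro Ck_on_SucI[where D = "\<lambda>p v. v *\<^sub>R (c * a * p powr (a - 1))"]) auto
qed

lemma Cinf_on_cong:
  "open U \<Longrightarrow> (\<And>p. p \<in> U \<Longrightarrow> f p = g p) \<Longrightarrow> Cinf_on U f \<longleftrightarrow> Cinf_on U g"
  using Ck_on_cong unfolding Cinf_on_def by blast

lemma Cinf_on_imp_continuous_on: "Cinf_on U f \<Longrightarrow> continuous_on U f"
  using Ck_on_imp_continuous_on unfolding Cinf_on_def by blast

lemma Cinf_on_has_derivative:
  "Cinf_on U f \<Longrightarrow> p \<in> U \<Longrightarrow> (f has_derivative frechet_derivative f (at p)) (at p)"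
  using Ck_on_SucD unfolding Cinf_on_def by blast

lemma Cinf_on_frechet_derivative: "Cinf_on U f \<Longrightarrow> Cinf_on U (\<lambda>p. frechet_derivative f (at p) v)"
  unfolding Cinf_on_def by (metis Ck_on.simps(2))

lemma Cinf_on_const [simp]: "open U \<Longrightarrow> Cinf_on U (\<lambda>p. c)"
  by (simp add: Cinf_on_def Ck_on_const)

lemma Cinf_on_bounded_linear:
  assumes L: "bounded_linear L" and U: "open U"
  shows "Cinf_on U (\<lambda>p. L p)"
  unfolding Cinf_on_def
proof
  fix k
  show "Ck_on k U (\<lambda>p. L p)"
  proof (cases k)
    case 0
    then show ?thesis using L by (auto intro: linear_continuous_on)
  next
    case (Suc j)
    show ?thesis unfolding Suc
      by (rule Ck_on_SucI[OF U bounded_linear.has_derivative[OF L has_derivative_ident]])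
        (rule Ck_on_const[OF U])
  qed
qed

lemma Cinf_on_bounded_linear_compose:
  "bounded_linear L \<Longrightarrow> open U \<Longrightarrow> Cinf_on U f \<Longrightarrow> Cinf_on U (\<lambda>p. L (f p))"
  by (simp add: Cinf_on_def Ck_on_bounded_linear_compose)

lemma Cinf_on_bilinear:
  "bounded_bilinear B \<Longrightarrow> open U \<Longrightarrow> Cinf_on U f \<Longrightarrow> Cinf_on U g \<Longrightarrow> Cinf_on U (\<lambda>p. B (f p) (g p))"
  by (simp add: Cinf_on_def Ck_on_bilinear)

lemma Cinf_on_add: "open U \<Longrightarrow> Cinf_on U f \<Longrightarrow> Cinf_on U g \<Longrightarrow> Cinf_on U (\<lambda>p. f p + g p)"
  by (simp add: Cinf_on_def Ck_on_add)

lemma Cinf_on_compose: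
  fixes f :: "'a::euclidean_space \<Rightarrow> 'b::euclidean_space" and g :: "'b \<Rightarrow> 'c::real_normed_vector"
  shows "Cinf_on V g \<Longrightarrow> open U \<Longrightarrow> open V \<Longrightarrow> Cinf_on U f \<Longrightarrow> (\<And>p. p \<in> U \<Longrightarrow> f p \<in> V) \<Longrightarrow>
    Cinf_on U (\<lambda>p. g (f p))"
  unfolding Cinf_on_def using Ck_on_compose[of U V f _ g] by blast

lemma Cinf_on_subset: "Cinf_on V f \<Longrightarrow> open U \<Longrightarrow> open V \<Longrightarrow> U \<subseteq> V \<Longrightarrow> Cinf_on U f"
  using Cinf_on_compose[of V f U "\<lambda>p. p"] Cinf_on_bounded_linear[OF bounded_linear_ident, of U]
  by blast

lemma Cinf_on_mult:
  fixes f g :: "_ \<Rightarrow> 'b::real_normed_algebra"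
  shows "open U \<Longrightarrow> Cinf_on U f \<Longrightarrow> Cinf_on U g \<Longrightarrow> Cinf_on U (\<lambda>p. f p * g p)"
  by (rule Cinf_on_bilinear[OF bounded_bilinear_mult])

lemma Cinf_on_uminus: "open U \<Longrightarrow> Cinf_on U f \<Longrightarrow> Cinf_on U (\<lambda>p. - f p)"
  by (rule Cinf_on_bounded_linear_compose[OF bounded_linear_minus[OF bounded_linear_ident]])

lemma Cinf_on_diff: "open U \<Longrightarrow> Cinf_on U f \<Longrightarrow> Cinf_on U g \<Longrightarrow> Cinf_on U (\<lambda>p. f p - g p)"
  using Cinf_on_add[of U f "\<lambda>p. - g p"] Cinf_on_uminus[of U g] by simp

lemma Cinf_on_power:
  fixes f :: "_ \<Rightarrow> 'b::real_normed_algebra_1"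
  shows "open U \<Longrightarrow> Cinf_on U f \<Longrightarrow> Cinf_on U (\<lambda>p. f p ^ n)"
  by (induction n) (auto intro: Cinf_on_mult)

lemma Cinf_on_Pair:
  assumes U: "open U" and f: "Cinf_on U f" and g: "Cinf_on U g"
  shows "Cinf_on U (\<lambda>p. (f p, g p))"
proof -
  have "Cinf_on U (\<lambda>p. (f p, 0) + (0, g p))"
    by (intro Cinf_on_add U
        Cinf_on_bounded_linear_compose[OF
          bounded_linear_Pair[OF bounded_linear_ident bounded_linear_zero] U f]
        Cinf_on_bounded_linear_compose[OF
          bounded_linear_Pair[OF bounded_linear_zero bounded_linear_ident] U g])
  then show ?thesis by simp
qed

lemma Cinf_on_powr:
  fixes f :: "_ \<Rightarrow> real"
  assumes "open U" "Cinf_on U f" "\<And>p. p \<in> U \<Longrightarrow> 0 < f p"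
  shows "Cinf_on U (\<lambda>p. f p powr a)"
  by (rule Cinf_on_compose[where V = "{0<..}" and g = "\<lambda>t. t powr a" and f = f])
    (use Ck_on_powr[of _ 1 a] assms in \<open>auto simp: Cinf_on_def\<close>)

lemma Cinf_on_sqrt:
  fixes f :: "_ \<Rightarrow> real"
  assumes "open U" "Cinf_on U f" "\<And>p. p \<in> U \<Longrightarrow> 0 < f p"
  shows "Cinf_on U (\<lambda>p. sqrt (f p))"
  using Cinf_on_powr[OF assms, of "1/2"]
  by (rule iffD1[OF Cinf_on_cong, rotated 2]) (use assms in \<open>auto simp: powr_half_sqrt less_imp_le\<close>)

lemma Cinf_on_inverse_pos:
  assumes "open U" "Cinf_on U f" "\<And>p. p \<in> U \<Longrightarrow> 0 < f p"
  shows "Cinf_on U (\<lambda>p. inverse (f p :: real))"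
  using Cinf_on_powr[OF assms, of "-1"]
  by (rule iffD1[OF Cinf_on_cong, rotated 2]) (use assms in \<open>auto simp: powr_minus less_imp_le\<close>)

text \<open>As \<open>f / g = f g / g\<^sup>2\<close>, inverses of positive functions suffice.\<close>

lemma Cinf_on_divide:
  fixes f g :: "_ \<Rightarrow> real"
  assumes "open U" "Cinf_on U f" "Cinf_on U g" "\<And>p. p \<in> U \<Longrightarrow> g p \<noteq> 0"
  shows "Cinf_on U (\<lambda>p. f p / g p)"
proof -
  have "Cinf_on U (\<lambda>p. f p * g p * inverse (g p ^ 2))"
    using assms by (intro Cinf_on_mult Cinf_on_inverse_pos Cinf_on_power) auto
  then show ?thesis
    by (rule iffD1[OF Cinf_on_cong, rotated 2])
      (use assms in \<open>auto simp: power2_eq_square field_simps\<close>)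
qed

lemma Cinf_on_norm:
  fixes f :: "_ \<Rightarrow> 'b::real_inner"
  assumes "open U" "Cinf_on U f" "\<And>p. p \<in> U \<Longrightarrow> f p \<noteq> 0"
  shows "Cinf_on U (\<lambda>p. norm (f p))"
  unfolding norm_eq_sqrt_inner
  using assms by (intro Cinf_on_sqrt Cinf_on_bilinear[OF bounded_bilinear_inner]) auto

lemmas Cinf_on_Re = Cinf_on_bounded_linear_compose[OF bounded_linear_Re]
lemmas Cinf_on_Im = Cinf_on_bounded_linear_compose[OF bounded_linear_Im]
lemmas Cinf_on_cnj = Cinf_on_bounded_linear_compose[OF bounded_linear_cnj]
lemmas Cinf_on_of_real = Cinf_on_bounded_linear_compose[OF bounded_linear_of_real]
lemmas Cinf_on_fst = Cinf_on_bounded_linear_compose[OF bounded_linear_fst]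
lemmas Cinf_on_snd = Cinf_on_bounded_linear_compose[OF bounded_linear_snd]
lemmas Cinf_on_ident = Cinf_on_bounded_linear[OF bounded_linear_ident]
lemma Cinf_on_scaleR:
  "open U \<Longrightarrow> Cinf_on U f \<Longrightarrow> Cinf_on U g \<Longrightarrow> Cinf_on U (\<lambda>p. f p *\<^sub>R g p)"
  by (rule Cinf_on_bilinear[OF bounded_bilinear_scaleR])

lemmas Cinf_intros = Cinf_on_const Cinf_on_ident Cinf_on_add Cinf_on_diff Cinf_on_uminus
  Cinf_on_mult Cinf_on_power Cinf_on_Pair Cinf_on_scaleR Cinf_on_Re Cinf_on_Im Cinf_on_cnj
    Cinf_on_of_real Cinf_on_fst Cinf_on_snd
  Cinf_on_divide Cinf_on_sqrt Cinf_on_norm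

lemma smooth_onI: "open U \<Longrightarrow> A \<subseteq> U \<Longrightarrow> Cinf_on U f \<Longrightarrow> smooth_on A f"
  unfolding smooth_on_def by (auto intro!: exI[of _ U] exI[of _ f])

lemma smooth_on_imp_continuous_on:
  assumes "smooth_on A f"
  shows "continuous_on A f"
proof -
  have "continuous (at p within A) f" if p: "p \<in> A" for p
  proof -
    obtain U g where U: "open U" "p \<in> U" "Cinf_on U g" "\<forall>q\<in>U \<inter> A. g q = f q"
      using assms p unfolding smooth_on_def by blast
    have "isCont g p"
      using Cinf_on_imp_continuous_on[OF U(3)] U(1,2) by (simp add: continuous_on_eq_continuous_at)
    then have "continuous (at p within A) g"
      by (rule continuous_at_imp_continuous_at_within)
    moreover have "eventually (\<lambda>q. g q = f q) (at p within A)"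
      using U(1,2,4) unfolding eventually_at_topological by (intro exI[of _ U]) auto
    ultimately show ?thesis using p U(2,4) tendsto_cong[of g f "at p within A" "g p"]
      unfolding continuous_within by simp
  qed
  then show ?thesis by (simp add: continuous_on_eq_continuous_within)
qed

section \<open>Wedge products in low degree\<close>

lemma wedge_1_1:
  assumes "\<And>v. \<alpha> p v = a (v 0)" "\<And>v. \<beta> p v = b (v 0)"
  shows "wedge 1 1 \<alpha> \<beta> p v = a (v 0) * b (v 1) - a (v 1) * b (v 0)"
proof -
  have s: "{..<1 + 1::nat} = insert 0 {1}" by auto
  show ?thesis
    unfolding wedge_def assms s
    by (subst sum_over_permutations_insert)
      (auto simp: permutes_sing sign_swap_id sign_id transpose_def)
qed

lemma wedge_k_0:
  assumes "k \<le> 1" "\<And>v w. (\<And>i. i < k \<Longrightarrow> v i = w i) \<Longrightarrow> \<alpha> p v = \<alpha> p w" "\<And>v. \<beta> p v = b"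
  shows "wedge k 0 \<alpha> \<beta> p v = b * \<alpha> p v"
proof -
  have s: "{\<sigma>. \<sigma> permutes {..<k + 0}} = {id}"
    using assms(1) by (cases "k = 0") (auto simp: permutes_sing lessThan_Suc le_Suc_eq)
  show ?thesis
    unfolding wedge_def s using assms(1,3) by (auto simp: sign_id le_Suc_eq)
qed

lemma wedge_2_0:
  assumes "\<And>v. \<alpha> p v = F (v 0) (v 1)" "\<And>u w. F u w = - F w u" "\<And>v. \<beta> p v = 1"
  shows "wedge 2 0 \<alpha> \<beta> p v = F (v 0) (v 1)"
proof -
  have s: "{..<2 + 0::nat} = insert 0 {1}" by auto
  show ?thesis
    unfolding wedge_def assms(1,3) s
    by (subst sum_over_permutations_insert)
      (auto simp: permutes_sing sign_swap_id sign_id transpose_def assms(2)[of "v (Suc 0)" "v 0"])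
qed

lemma wedge_1_2:
  assumes "\<And>v. \<alpha> p v = a (v 0)" "\<And>v. \<beta> p v = F (v 0) (v 1)" "\<And>u w. F u w = - F w u"
  shows "wedge 1 2 \<alpha> \<beta> p v
    = a (v 0) * F (v 1) (v 2) - a (v 1) * F (v 0) (v 2) + a (v 2) * F (v 0) (v 1)"
proof -
  have s: "{..<1 + 2::nat} = insert 0 (insert 1 {2})" by auto
  note F = assms(3)[of "v (Suc 0)" "v 0"] assms(3)[of "v (Suc (Suc 0))" "v 0"]
    assms(3)[of "v (Suc (Suc 0))" "v (Suc 0)"]
  show ?thesis
    unfolding wedge_def assms(1,2) s
    by (subst sum_over_permutations_insert, simp, simp)+
      (simp add: permutes_sing sign_swap_id sign_id sign_compose permutation_swap_id swap_id_eq,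
        simp add: transpose_def numeral_2_eq_2 F)
qed

lemma wedge_2_2:
  assumes "\<And>v. \<alpha> p v = F (v 0) (v 1)" "\<And>v. \<beta> p v = F (v 0) (v 1)" "\<And>u w. F u w = - F w u"
  shows "wedge 2 2 \<alpha> \<beta> p v = 2 * (F (v 0) (v 1) * F (v 2) (v 3) - F (v 0) (v 2) * F (v 1) (v 3)
    + F (v 0) (v 3) * F (v 1) (v 2))"
proof -
  have s: "{..<2 + 2::nat} = insert 0 (insert 1 (insert 2 {3}))" by auto
  note F = assms(3)[of "v (Suc 0)" "v 0"] assms(3)[of "v (Suc (Suc 0))" "v 0"]
    assms(3)[of "v (Suc (Suc 0))" "v (Suc 0)"] assms(3)[of "v (Suc (Suc (Suc 0)))" "v 0"]
    assms(3)[of "v (Suc (Suc (Suc 0)))" "v (Suc 0)"]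
    assms(3)[of "v (Suc (Suc (Suc 0)))" "v (Suc (Suc 0))"]
  show ?thesis
    unfolding wedge_def assms(1,2) s
    by (subst sum_over_permutations_insert, simp, simp)+
      (simp add: permutes_sing sign_swap_id sign_id sign_compose permutation_swap_id
        permutation_compose swap_id_eq,
        simp add: transpose_def numeral_2_eq_2 numeral_3_eq_3 fact_numeral F)
qed

section \<open>The symplectic form\<close>

definition mz :: "mcgehee \<Rightarrow> complex" where "mz = (\<lambda>(x, z, Pr, P\<phi>). z)"

lemma mcgehee_proj [simp]:
  "mx (x, z, r, P) = x" "mz (x, z, r, P) = z" "mPr (x, z, r, P) = r" "mP\<phi> (x, z, r, P) = P"
  by (simp_all add: mx_def mz_def mPr_def mP\<phi>_def)

lemma mcgehee_eqI: "mx s = mx t \<Longrightarrow> mz s = mz t \<Longrightarrow> mPr s = mPr t \<Longrightarrow> mP\<phi> s = mP\<phi> t \<Longrightarrow> s = t"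
  by (cases s, cases t) auto

lemma mcgehee_proj_bounded_linear:
  "bounded_linear mx" "bounded_linear mz" "bounded_linear mPr" "bounded_linear mP\<phi>"
proof -
  have "mx = fst" "mz = (\<lambda>s. fst (snd s))" "mPr = (\<lambda>s. fst (snd (snd s)))"
    "mP\<phi> = (\<lambda>s. snd (snd (snd s)))"
    by (auto simp: fun_eq_iff)
  moreover have "bounded_linear (\<lambda>s::mcgehee. fst (snd s))"
    "bounded_linear (\<lambda>s::mcgehee. fst (snd (snd s)))"
    "bounded_linear (\<lambda>s::mcgehee. snd (snd (snd s)))"
    by (intro bounded_linear_fst_comp bounded_linear_snd_comp bounded_linear_snd)+
  ultimately show "bounded_linear mx" "bounded_linear mz" "bounded_linear mPr" "bounded_linear mP\<phi>"
    using bounded_linear_fst by simp_all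
qed

lemmas mcgehee_proj_linear = mcgehee_proj_bounded_linear[THEN bounded_linear.linear]

lemma mcgehee_proj_linear_simps [simp]:
  "mx 0 = 0" "mz 0 = 0" "mPr 0 = 0" "mP\<phi> 0 = 0"
  "mx (u + v) = mx u + mx v" "mz (u + v) = mz u + mz v" "mPr (u + v) = mPr u + mPr v"
  "mP\<phi> (u + v) = mP\<phi> u + mP\<phi> v"
  "mx (u - v) = mx u - mx v" "mz (u - v) = mz u - mz v" "mPr (u - v) = mPr u - mPr v"
  "mP\<phi> (u - v) = mP\<phi> u - mP\<phi> v"
  "mx (- v) = - mx v" "mz (- v) = - mz v" "mPr (- v) = - mPr v" "mP\<phi> (- v) = - mP\<phi> v"
  "mx (a *\<^sub>R v) = a * mx v" "mz (a *\<^sub>R v) = a *\<^sub>R mz v" "mPr (a *\<^sub>R v) = a * mPr v"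
  "mP\<phi> (a *\<^sub>R v) = a * mP\<phi> v"
  by (cases u, cases v, simp add: zero_prod_def)+

lemmas mcgehee_proj_continuous_on [continuous_intros] =
  mcgehee_proj_bounded_linear[THEN bounded_linear.continuous_on]
lemmas Cinf_on_mcgehee_proj = mcgehee_proj_bounded_linear[THEN Cinf_on_bounded_linear]
  mcgehee_proj_bounded_linear[THEN Cinf_on_bounded_linear_compose]

lemma frechet_derivative_mcgehee_proj [simp]:
  "frechet_derivative mx (at s) v = mx v" "frechet_derivative mPr (at s) v = mPr v"
  "frechet_derivative mP\<phi> (at s) v = mP\<phi> v"
  using frechet_derivative_at[OF bounded_linear_imp_has_derivative]
    mcgehee_proj_bounded_linear by (metis (no_types))+

lemma Y_field_proj [simp]:
  "mx (Y_field s) = 0" "mz (Y_field s) = 0" "mPr (Y_field s) = mPr s" "mP\<phi> (Y_field s) = mP\<phi> s"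
  by (cases s, simp add: Y_field_def)+

lemma Y_field_bounded_linear: "bounded_linear Y_field"
proof -
  have eq: "Y_field = (\<lambda>s. (0, 0, mPr s, mP\<phi> s))" by (auto simp: fun_eq_iff Y_field_def)
  show ?thesis
    unfolding eq by (intro bounded_linear_Pair bounded_linear_zero mcgehee_proj_bounded_linear)
qed

text \<open>The angular velocity \<open>d\<phi> = Im (dz / z)\<close> of a vector.\<close>

definition ang :: "mcgehee \<Rightarrow> mcgehee \<Rightarrow> real" where
  "ang s v = Im (mz v / mz s)"

lemma ang_linear_simps [simp]:
  "ang s 0 = 0" "ang s (u + v) = ang s u + ang s v" "ang s (u - v) = ang s u - ang s v"
  "ang s (- v) = - ang s v" "ang s (a *\<^sub>R v) = a * ang s v" "ang s (Y_field t) = 0"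
  by (simp_all add: ang_def add_divide_distrib diff_divide_distrib scaleR_conv_of_real
      flip: times_divide_eq_right)

lemma d\<phi>_eq_ang: "d\<phi> s v = ang s (v 0)"
  by (cases s, cases "v 0") (auto simp: d\<phi>_def ang_def)

definition symp_at :: "mcgehee \<Rightarrow> mcgehee \<Rightarrow> mcgehee \<Rightarrow> real" where
  "symp_at s u v = - (4 / mx s ^ 3) * (mx u * mPr v - mx v * mPr u)
     + (ang s u * mP\<phi> v - ang s v * mP\<phi> u)"

lemma symp_at_antisym: "symp_at s u v = - symp_at s v u"
  by (simp add: symp_at_def algebra_simps del: times_divide_eq_left times_divide_eq_right)

lemma symp_form_eq: "symp_form s v = symp_at s (v 0) (v 1)"
  unfolding symp_form_def symp_at_def
  by (subst (1 2) wedge_1_1) (auto simp: differential_def d\<phi>_eq_ang)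

lemma wedge_dx_dPr: "wedge 1 1 (differential mx) (\<lambda>s v. - 4 * mPr (v 0)) s v =
    - 4 * (mx (v 0) * mPr (v 1) - mx (v 1) * mPr (v 0))"
  by (subst wedge_1_1) (auto simp: differential_def algebra_simps)

definition liou_at :: "mcgehee \<Rightarrow> mcgehee \<Rightarrow> real" where
  "liou_at s v = 4 * mPr s / mx s ^ 3 * mx v - mP\<phi> s * ang s v"

lemma contract_Y_symp_form: "contract Y_field symp_form s v = liou_at s (v 0)"
  by (simp add: contract_def symp_form_eq symp_at_def liou_at_def)

lemmas mcgehee_proj_has_derivative_at =
  mcgehee_proj_bounded_linear[THEN bounded_linear.has_derivative, OF has_derivative_ident]

lemma ang_has_derivative:
  assumes "mz s \<noteq> 0"
  shows "((\<lambda>q. ang q u) has_derivative (\<lambda>w. - Im (mz u * mz w / (mz s)\<^sup>2))) (at s)"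
proof -
  have "((\<lambda>q. Im (mz u * inverse (mz q))) has_derivative
      (\<lambda>w. Im (mz u * - (inverse (mz s) * mz w * inverse (mz s))))) (at s)"
    using assms by (intro has_derivative_Im has_derivative_mult_right Deriv.has_derivative_inverse
        mcgehee_proj_has_derivative_at)
  then show ?thesis unfolding ang_def divide_inverse
    by (rule has_derivative_eq_rhs) (simp add: fun_eq_iff power2_eq_square algebra_simps)
qed

lemma four_over_cube_has_derivative:
  assumes "mx s \<noteq> 0"
  shows "((\<lambda>q. 4 / mx q ^ 3) has_derivative (\<lambda>w. - 12 * mx w / mx s ^ 4)) (at s)"
proof -
  have "((\<lambda>x::real. 4 / x ^ 3) has_real_derivative - 12 / mx s ^ 4) (at (mx s))"
    using assms by (auto intro!: derivative_eq_intros simp: field_simps eval_nat_numeral)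
  then show ?thesis
    using has_derivative_compose[OF mcgehee_proj_has_derivative_at(1)]
    by (fastforce simp: has_field_derivative_def)
qed

lemma liou_at_has_derivative:
  assumes "mx s \<noteq> 0" "mz s \<noteq> 0"
  shows "((\<lambda>q. liou_at q u) has_derivative
    (\<lambda>w. (mPr w * (4 / mx s ^ 3) - mPr s * (12 * mx w / mx s ^ 4)) * mx u
     - mP\<phi> w * ang s u + mP\<phi> s * Im (mz u * mz w / (mz s)\<^sup>2))) (at s)"
proof -
  have e: "liou_at q u = mPr q * (4 / mx q ^ 3) * mx u - mP\<phi> q * ang q u" for q
    by (simp add: liou_at_def)
  show ?thesis unfolding e
    by (rule has_derivative_eq_rhs[OF has_derivative_diff[OF
            has_derivative_mult_left[OF has_derivative_mult[OF mcgehee_proj_has_derivative_at(3)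
                four_over_cube_has_derivative[OF assms(1)]]]
            has_derivative_mult[OF mcgehee_proj_has_derivative_at(4)
              ang_has_derivative[OF assms(2)]]]])
      (auto simp: fun_eq_iff algebra_simps)
qed

lemma symp_at_has_derivative:
  assumes "mx s \<noteq> 0" "mz s \<noteq> 0"
  shows "((\<lambda>q. symp_at q u v) has_derivative
    (\<lambda>w. (12 * mx w / mx s ^ 4) * (mx u * mPr v - mx v * mPr u)
     - Im (mz u * mz w / (mz s)\<^sup>2) * mP\<phi> v + Im (mz v * mz w / (mz s)\<^sup>2) * mP\<phi> u)) (at s)"
  unfolding symp_at_def
  by (rule has_derivative_eq_rhs[OF has_derivative_add[OF
          has_derivative_mult_left[OF has_derivative_minus[OF
              four_over_cube_has_derivative[OF assms(1)]]]
          has_derivative_diff[OF has_derivative_mult_left[OF ang_has_derivative[OF assms(2)]]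
            has_derivative_mult_left[OF ang_has_derivative[OF assms(2)]]]]])
    (auto simp: fun_eq_iff algebra_simps)

lemma ext_deriv_contract_Y_symp_form:
  assumes "mx s \<noteq> 0" "mz s \<noteq> 0"
  shows "ext_deriv 1 (contract Y_field symp_form) s v = symp_at s (v 0) (v 1)"
proof -
  have "{..1::nat} = {0, 1}" by auto
  then have "ext_deriv 1 (contract Y_field symp_form) s v
      = frechet_derivative (\<lambda>q. liou_at q (v 1)) (at s) (v 0)
        - frechet_derivative (\<lambda>q. liou_at q (v 0)) (at s) (v 1)"
    by (simp add: ext_deriv_def contract_Y_symp_form)
  also have "\<dots> = symp_at s (v 0) (v 1)"
    unfolding frechet_derivative_at[OF liou_at_has_derivative[OF assms], symmetric] symp_at_def
    by (simp add: algebra_simps)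
  finally show ?thesis .
qed

text \<open>The derivative of \<open>4 / x\<^sup>3\<close> contributes a multiple of \<open>dx \<and> dx \<and> dP\<^sub>r\<close>, and \<open>d\<phi> = Im (dz /
  z)\<close> is closed because its derivative \<open>- Im (dz dz / z\<^sup>2)\<close> is symmetric.\<close>

lemma ext_deriv_symp_form:
  assumes "mx s \<noteq> 0" "mz s \<noteq> 0"
  shows "ext_deriv 2 symp_form s v = 0"
proof -
  have "{..2::nat} = {0, 1, 2}" by auto
  then have "ext_deriv 2 symp_form s v
      = frechet_derivative (\<lambda>q. symp_at q (v 1) (v 2)) (at s) (v 0)
        - frechet_derivative (\<lambda>q. symp_at q (v 0) (v 2)) (at s) (v 1)
        + frechet_derivative (\<lambda>q. symp_at q (v 0) (v 1)) (at s) (v 2)"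
    by (simp add: ext_deriv_def symp_form_eq numeral_2_eq_2)
  also have "\<dots> = 0"
    unfolding frechet_derivative_at[OF symp_at_has_derivative[OF assms], symmetric]
    by (simp add: algebra_simps add_divide_distrib diff_divide_distrib)
  finally show ?thesis .
qed

text \<open>The coefficients of \<open>\<omega>\<close> are constant along \<open>Y\<close>, and every term of \<open>\<omega>\<close> contains exactly
  one differential of a momentum, on which \<open>Y\<close> acts as the identity.\<close>

lemma lie_deriv_symp_form:
  assumes "mx s \<noteq> 0" "mz s \<noteq> 0"
  shows "lie_deriv 2 Y_field symp_form s v = symp_form s v"
proof -
  have "{..<2::nat} = {0, 1}" by auto
  moreover have "frechet_derivative Y_field (at s) = Y_field"
    using frechet_derivative_at[OF bounded_linear_imp_has_derivative[OF Y_field_bounded_linear]] ..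
  ultimately have "lie_deriv 2 Y_field symp_form s v
      = frechet_derivative (\<lambda>q. symp_at q (v 0) (v 1)) (at s) (Y_field s)
        + (symp_at s (Y_field (v 0)) (v 1) + symp_at s (v 0) (Y_field (v 1)))"
    by (simp add: lie_deriv_def symp_form_eq)
  also have "frechet_derivative (\<lambda>q. symp_at q (v 0) (v 1)) (at s) (Y_field s) = 0"
    unfolding frechet_derivative_at[OF symp_at_has_derivative[OF assms], symmetric] by simp
  also have "symp_at s (Y_field (v 0)) (v 1) + symp_at s (v 0) (Y_field (v 1))
    = symp_at s (v 0) (v 1)"
    unfolding symp_at_def
    by (simp add: algebra_simps del: times_divide_eq_left times_divide_eq_right)
  finally show ?thesis using symp_form_eq[of s v] by argo
qed

lemma symp_form_volume:
  "wedge_power symp_form 2 s v =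
    2 * (symp_at s (v 0) (v 1) * symp_at s (v 2) (v 3)
      - symp_at s (v 0) (v 2) * symp_at s (v 1) (v 3)
    + symp_at s (v 0) (v 3) * symp_at s (v 1) (v 2))"
proof -
  have "wedge 2 0 symp_form (\<lambda>p v. 1) s v = symp_at s (v 0) (v 1)" for v
    by (rule wedge_2_0[where F = "symp_at s"]) (rule symp_form_eq symp_at_antisym refl)+
  then have "wedge 2 2 symp_form (wedge 2 0 symp_form (\<lambda>p v. 1)) s v =
    2 * (symp_at s (v 0) (v 1) * symp_at s (v 2) (v 3)
      - symp_at s (v 0) (v 2) * symp_at s (v 1) (v 3)
    + symp_at s (v 0) (v 3) * symp_at s (v 1) (v 2))"
    by (intro wedge_2_2[where F = "symp_at s"]) (rule symp_form_eq symp_at_antisym | assumption)+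
  then show ?thesis by (simp add: numeral_2_eq_2)
qed

lemma contact_volume:
  assumes "mx s \<noteq> 0" "mz s \<noteq> 0"
  shows "wedge 1 2 (contract Y_field symp_form)
      (wedge_power (ext_deriv 1 (contract Y_field symp_form)) 1) s v =
    liou_at s (v 0) * symp_at s (v 1) (v 2) - liou_at s (v 1) * symp_at s (v 0) (v 2)
    + liou_at s (v 2) * symp_at s (v 0) (v 1)"
proof (rule wedge_1_2)
  have "wedge 2 0 (ext_deriv 1 (contract Y_field symp_form)) (\<lambda>p v. 1) s v = symp_at s (v 0) (v 1)"
    for v
    by (rule wedge_2_0[where F = "symp_at s"])
      (rule ext_deriv_contract_Y_symp_form[OF assms] symp_at_antisym refl)+
  then show "wedge_power (ext_deriv 1 (contract Y_field symp_form)) 1 s v = symp_at s (v 0) (v 1)"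
    for v
    by simp
  show "contract Y_field symp_form s v = liou_at s (v 0)" for v by (rule contract_Y_symp_form)
qed (rule symp_at_antisym)

lemma alternating_0: "alternating 0 (\<lambda>v. c)"
  by (simp add: alternating_def)

lemma alternating_1: "linear f \<Longrightarrow> alternating 1 (\<lambda>v. f (v 0))"
  by (simp add: alternating_def)

lemma alternating_2:
  assumes "\<And>w. linear (\<lambda>u. F u w)" "\<And>u. linear (F u)" "\<And>u. F u u = 0"
  shows "alternating 2 (\<lambda>v. F (v 0) (v 1))"
  using assms by (auto simp: alternating_def less_2_cases_iff)

lemma open_mz_nonzero: "open {s. mz s \<noteq> 0}"
  by (intro open_Collect_neq continuous_intros)

lemma Cinf_on_ang: "Cinf_on {s. mz s \<noteq> 0} (\<lambda>s. ang s u)"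
proof -
  have "Cinf_on {s. mz s \<noteq> 0} (\<lambda>s. Im (mz u * cnj (mz s)) / (cmod (mz s))\<^sup>2)"
    by (intro Cinf_intros Cinf_on_mcgehee_proj open_mz_nonzero) auto
  moreover have "ang s u = Im (mz u * cnj (mz s)) / (cmod (mz s))\<^sup>2" for s
    by (simp only: ang_def complex_div_cnj[of _ "mz s"] Im_divide_of_real flip: of_real_power)
  ultimately show ?thesis by simp
qed

lemma bm_formI:
  assumes "1 \<le> k" "open U" "N \<subseteq> U" "Cinf_on U x" "smooth_form U (k - 1) \<eta>" "smooth_form U k \<beta>"
    "\<And>p v. p \<in> U \<Longrightarrow> \<omega> p v = wedge 1 (k - 1) (differential x) \<eta> p v / x p ^ m + \<beta> p v"
  shows "bm_form m N x k \<omega>"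
  using assms unfolding bm_form_def by blast

lemma bm_form_symp_form:
  assumes "\<And>s. s \<in> N \<Longrightarrow> mz s \<noteq> 0"
  shows "bm_form 3 N mx 2 symp_form"
proof -
  let ?U = "{s. mz s \<noteq> 0}"
  let ?\<eta> = "\<lambda>(s::mcgehee) v. - 4 * mPr (v (0::nat))"
  let ?\<beta> = "\<lambda>(s::mcgehee) v. ang s (v (0::nat)) * mP\<phi> (v 1) - ang s (v 1) * mP\<phi> (v 0)"
  have "alternating 1 (?\<eta> s)" for s
    by (rule alternating_1) (simp add: linear_iff algebra_simps)
  then have "smooth_form ?U 1 ?\<eta>"
    unfolding smooth_form_def by (intro conjI ballI allI Cinf_intros open_mz_nonzero)
  moreover have "alternating 2 (?\<beta> s)" for s
    by (rule alternating_2) (simp_all add: linear_iff algebra_simps)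
  then have "smooth_form ?U 2 ?\<beta>"
    unfolding smooth_form_def by (intro conjI ballI allI Cinf_intros Cinf_on_ang open_mz_nonzero)
  moreover have "symp_form p v = wedge 1 (2 - 1) (differential mx) ?\<eta> p v / mx p ^ 3 + ?\<beta> p v"
    for p v
    using wedge_dx_dPr[of p v] by (simp add: symp_form_eq symp_at_def diff_divide_distrib)
  ultimately show ?thesis
    using assms open_mz_nonzero Cinf_on_mcgehee_proj(1)
    by (intro bm_formI[where U = ?U and \<eta> = ?\<eta> and \<beta> = ?\<beta>]) auto
qed

lemma bm_form_contract_Y_symp_form:
  assumes "\<And>s. s \<in> N \<Longrightarrow> mz s \<noteq> 0"
  shows "bm_form 3 N mx 1 (contract Y_field symp_form)"
proof -
  let ?U = "{s. mz s \<noteq> 0}"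
  let ?\<eta> = "\<lambda>s (v::nat \<Rightarrow> mcgehee). 4 * mPr s"
  let ?\<beta> = "\<lambda>(s::mcgehee) v. - mP\<phi> s * ang s (v (0::nat))"
  have "smooth_form ?U 0 ?\<eta>"
    unfolding smooth_form_def
    by (intro conjI ballI allI alternating_0 Cinf_intros Cinf_on_mcgehee_proj open_mz_nonzero)
  moreover have "alternating 1 (?\<beta> s)" for s
    by (rule alternating_1) (simp add: linear_iff algebra_simps)
  then have "smooth_form ?U 1 ?\<beta>"
    unfolding smooth_form_def
    by (intro conjI ballI allI Cinf_intros Cinf_on_mcgehee_proj Cinf_on_ang open_mz_nonzero)
  moreover have "contract Y_field symp_form p v
      = wedge 1 (1 - 1) (differential mx) ?\<eta> p v / mx p ^ 3 + ?\<beta> p v" for p v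
  proof -
    have "wedge 1 0 (differential mx) ?\<eta> p v = 4 * mPr p * differential mx p v"
      by (rule wedge_k_0) (simp_all add: differential_def)
    then show ?thesis by (simp add: contract_Y_symp_form liou_at_def differential_def)
  qed
  ultimately show ?thesis
    using assms open_mz_nonzero Cinf_on_mcgehee_proj(1)
    by (intro bm_formI[where U = ?U and \<eta> = ?\<eta> and \<beta> = ?\<beta>]) auto
qed

section \<open>The Hamiltonian near infinity\<close>

text \<open>Minus the potential in McGehee coordinates, with the powers of \<open>x\<close> of the two distances
  moved to the numerator; in this form it is smooth for negative \<open>x\<close> as well, as long as \<open>(x, z)\<close>
  avoids the zeros of the denominators.\<close>

definition pot :: "real \<Rightarrow> real \<times> complex \<Rightarrow> real" where
  "pot \<mu> = (\<lambda>(x, z). x\<^sup>2 * ((1 - \<mu>) / cmod (2 * z - of_real (\<mu> * x\<^sup>2))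
     + \<mu> / cmod (2 * z - of_real (- (1 - \<mu>) * x\<^sup>2))))"

definition noncoll :: "real \<Rightarrow> (real \<times> complex) set" where
  "noncoll \<mu> = {(x, z). 2 * z - of_real (\<mu> * x\<^sup>2) \<noteq> 0 \<and> 2 * z - of_real (- (1 - \<mu>) * x\<^sup>2) \<noteq> 0}"

abbreviation position :: "mcgehee \<Rightarrow> real \<times> complex" where
  "position s \<equiv> (mx s, mz s)"

lemma open_noncoll: "open (noncoll \<mu>)"
  unfolding noncoll_def case_prod_unfold by
    (intro open_Collect_conj open_Collect_neq continuous_intros)

lemma Cinf_on_pot: "Cinf_on (noncoll \<mu>) (pot \<mu>)"
  unfolding pot_def case_prod_unfold
  by (intro Cinf_intros open_noncoll) (auto simp: noncoll_def)

lemma pot_nonneg: "0 < \<mu> \<Longrightarrow> \<mu> < 1 \<Longrightarrow> 0 \<le> pot \<mu> y"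
  by (auto simp: pot_def split: prod.split)

lemma position_bounded_linear: "bounded_linear position"
  by (intro bounded_linear_Pair mcgehee_proj_bounded_linear)

lemma open_position_vimage: "open {s. position s \<in> noncoll \<mu>}"
  using open_vimage[OF open_noncoll, of "\<lambda>s. position s"]
    linear_continuous_on[OF position_bounded_linear, of UNIV]
  by (simp add: vimage_def)

lemma q_pos_minus_of_real:
  assumes "x \<noteq> 0"
  shows "q_pos (x, z, r, P) - of_real a = (2 * z - of_real (a * x\<^sup>2)) / of_real (x\<^sup>2)"
  using assms by (simp add: q_pos_def field_simps)

text \<open>Both branches of the definition agree with the one smooth formula; off \<open>noncoll\<close> the
  equation relies on division by zero giving zero on both sides.\<close>

lemma hamiltonian_eq:
  "hamiltonian \<mu> s = ((mPr s)\<^sup>2 + mx s ^ 4 * (mP\<phi> s)\<^sup>2 / 4) / 2 - mP\<phi> s - pot \<mu> (position s)"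
proof (cases s)
  case (fields x z r P)
  show ?thesis
  proof (cases "x = 0")
    case False
    have "cmod (q_pos (x, z, r, P) - of_real a) = cmod (2 * z - of_real (a * x\<^sup>2)) / x\<^sup>2" for a
      unfolding q_pos_minus_of_real[OF False] by (simp only: norm_divide norm_of_real) simp
    from this[of \<mu>] this[of "- (1 - \<mu>)"] False show ?thesis
      by (simp add: fields hamiltonian_def pot_def q_E_def q_M_def distrib_left mult.commute)
  qed (simp add: fields hamiltonian_def pot_def)
qed

lemma phase_space_iff:
  "s \<in> phase_space \<mu> \<longleftrightarrow> 0 \<le> mx s \<and> cmod (mz s) = 1 \<and> position s \<in> noncoll \<mu>"
proof (cases s)
  case (fields x z r P)
  show ?thesis
  proof (cases "x = 0")
    case False
    have "q_pos (x, z, r, P) = of_real a \<longleftrightarrow> 2 * z - of_real (a * x\<^sup>2) = 0" for a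
      using q_pos_minus_of_real[OF False, of z r P a] False by auto
    from this[of \<mu>] this[of "- (1 - \<mu>)"] False show ?thesis
      by (simp add: fields phase_space_def noncoll_def q_E_def q_M_def) auto
  qed (auto simp: fields phase_space_def noncoll_def)
qed

definition dpot :: "real \<Rightarrow> real \<times> complex \<Rightarrow> real \<times> complex \<Rightarrow> real" where
  "dpot \<mu> y = frechet_derivative (pot \<mu>) (at y)"

lemma pot_has_derivative: "y \<in> noncoll \<mu> \<Longrightarrow> (pot \<mu> has_derivative dpot \<mu> y) (at y)"
  unfolding dpot_def by (rule Cinf_on_has_derivative[OF Cinf_on_pot])

text \<open>The factor \<open>x\<^sup>2\<close> of the potential vanishes to second order. This is why the primaries do
  not influence the dynamics at infinity.\<close>

lemma dpot_at_infinity: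
  assumes "z \<noteq> 0"
  shows "dpot \<mu> (0, z) v = 0"
proof -
  define B :: "real \<times> complex \<Rightarrow> real" where
    "B = (\<lambda>(x, z). (1 - \<mu>) / cmod (2 * z - of_real (\<mu> * x\<^sup>2))
       + \<mu> / cmod (2 * z - of_real (- (1 - \<mu>) * x\<^sup>2)))"
  have y: "(0, z) \<in> noncoll \<mu>" using assms by (simp add: noncoll_def)
  have "Cinf_on (noncoll \<mu>) B"
    unfolding B_def case_prod_unfold
    by (intro Cinf_intros open_noncoll) (auto simp: noncoll_def)
  from Cinf_on_has_derivative[OF this y]
  obtain B' where B': "(B has_derivative B') (at (0, z))" by blast
  have "((\<lambda>y. (fst y)\<^sup>2) has_derivative (\<lambda>v. 0)) (at (0::real, z))"
    by (auto intro!: derivative_eq_intros)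
  from has_derivative_mult[OF this B'] have "(pot \<mu> has_derivative (\<lambda>v. 0)) (at (0, z))"
    by (simp add: pot_def B_def case_prod_unfold)
  then show ?thesis
    using has_derivative_unique[OF pot_has_derivative[OF y]] by (metis (no_types))
qed

text \<open>The derivative of the Hamiltonian, with the contribution of the potential kept abstract:
  the computations use only that it is linear, vanishes at infinity and does not depend on the
  momenta.\<close>

definition dH :: "real \<Rightarrow> mcgehee \<Rightarrow> mcgehee \<Rightarrow> real" where
  "dH \<mu> s v = mPr s * mPr v + mx s ^ 3 * (mP\<phi> s)\<^sup>2 / 2 * mx v
     + (mx s ^ 4 * mP\<phi> s / 4 - 1) * mP\<phi> v - dpot \<mu> (position s) (position v)"

lemma hamiltonian_has_derivative:
  assumes "position s \<in> noncoll \<mu>"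
  shows "(hamiltonian \<mu> has_derivative dH \<mu> s) (at s)"
proof -
  have pos: "((\<lambda>q. pot \<mu> (position q)) has_derivative (\<lambda>v. dpot \<mu> (position s) (position v)))
    (at s)"
    using has_derivative_compose[OF bounded_linear_imp_has_derivative[OF position_bounded_linear]
        pot_has_derivative[OF assms]] .
  have "((\<lambda>(x, r, P). (r\<^sup>2 + x ^ 4 * P\<^sup>2 / 4) / 2 - P) has_derivative
     (\<lambda>(x', r', P'). mPr s * r' + mx s ^ 3 * (mP\<phi> s)\<^sup>2 / 2 * x' + (mx s ^ 4 * mP\<phi> s / 4 - 1) * P'))
     (at (mx s, mPr s, mP\<phi> s))"
    unfolding case_prod_unfold
    by (auto intro!: derivative_eq_intros simp: fun_eq_iff algebra_simps power2_eq_square)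
  from has_derivative_compose[OF has_derivative_Pair[OF mcgehee_proj_has_derivative_at(1)
        has_derivative_Pair[OF mcgehee_proj_has_derivative_at(3,4)]] this]
  have "((\<lambda>q. ((mPr q)\<^sup>2 + mx q ^ 4 * (mP\<phi> q)\<^sup>2 / 4) / 2 - mP\<phi> q) has_derivative
     (\<lambda>v. mPr s * mPr v + mx s ^ 3 * (mP\<phi> s)\<^sup>2 / 2 * mx v + (mx s ^ 4 * mP\<phi> s / 4 - 1) * mP\<phi> v))
     (at s)"
    by simp
  from has_derivative_diff[OF this pos] show ?thesis
    by (simp add: dH_def[abs_def] hamiltonian_eq[abs_def])
qed

lemma Cinf_on_hamiltonian: "Cinf_on {s. position s \<in> noncoll \<mu>} (hamiltonian \<mu>)"
  unfolding hamiltonian_eq[abs_def]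
  by (intro Cinf_intros Cinf_on_mcgehee_proj open_position_vimage Cinf_on_compose[OF Cinf_on_pot]
      open_noncoll) auto

lemma dH_eq_frechet_derivative:
  "position s \<in> noncoll \<mu> \<Longrightarrow> frechet_derivative (hamiltonian \<mu>) (at s) = dH \<mu> s"
  using frechet_derivative_at[OF hamiltonian_has_derivative] by simp

lemma dH_bounded_linear: "position s \<in> noncoll \<mu> \<Longrightarrow> bounded_linear (dH \<mu> s)"
  using hamiltonian_has_derivative has_derivative_bounded_linear by blast

lemma dH_linear_simps:
  assumes "position s \<in> noncoll \<mu>"
  shows "dH \<mu> s (u + v) = dH \<mu> s u + dH \<mu> s v" "dH \<mu> s (u - v) = dH \<mu> s u - dH \<mu> s v"
    "dH \<mu> s (a *\<^sub>R v) = a * dH \<mu> s v"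
  using dH_bounded_linear[OF assms, THEN bounded_linear.linear]
  by (simp_all add: linear_add linear_diff linear_cmul)

text \<open>The derivative of the Hamiltonian along the Liouville field.\<close>

definition YH :: "mcgehee \<Rightarrow> real" where
  "YH s = (mPr s)\<^sup>2 + mx s ^ 4 * (mP\<phi> s)\<^sup>2 / 4 - mP\<phi> s"

lemma dH_Y_field:
  assumes "position s \<in> noncoll \<mu>"
  shows "dH \<mu> s (Y_field s) = YH s"
proof -
  have "dpot \<mu> (position s) 0 = 0"
    using pot_has_derivative[OF assms] has_derivative_linear linear_0 by blast
  then show ?thesis by (simp add: dH_def YH_def zero_prod_def power2_eq_square algebra_simps)
qed

lemma energy_level_iff:
  "s \<in> energy_level \<mu> c \<longleftrightarrow> 0 \<le> mx s \<and> cmod (mz s) = 1 \<and> position s \<in> noncoll \<mu> \<and> hamiltonian \<mu> s = c"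
  by (auto simp: energy_level_def phase_space_iff)

text \<open>On a positive level \<open>Y H\<close> is a sum of two nonnegative terms and the positive energy.\<close>

lemma YH_pos:
  assumes "0 < \<mu>" "\<mu> < 1" "0 < hamiltonian \<mu> s"
  shows "0 < YH s"
proof -
  have "YH s = ((mPr s)\<^sup>2 + mx s ^ 4 * (mP\<phi> s)\<^sup>2 / 4) / 2 + pot \<mu> (position s) + hamiltonian \<mu> s"
    by (simp add: hamiltonian_eq YH_def)
  moreover have "0 \<le> ((mPr s)\<^sup>2 + mx s ^ 4 * (mP\<phi> s)\<^sup>2 / 4) / 2" by simp
  ultimately show ?thesis using pot_nonneg[OF assms(1,2), of "position s"] assms(3) by linarith
qed

section \<open>The radial projection onto an energy level\<close>

definition kinetic :: "mcgehee \<Rightarrow> real" where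
  "kinetic s = ((mPr s)\<^sup>2 + mx s ^ 4 * (mP\<phi> s)\<^sup>2 / 4) / 2"

text \<open>The states whose ray of momenta, the orbit of \<open>Y\<close>, meets the positive energy levels.
  Along the ray the energy is \<open>k\<^sup>2 kinetic - k P\<^sub>\<phi> - pot\<close>, which takes positive values for some \<open>k >
  0\<close>, and then all of them, exactly under this condition.\<close>

definition ray_domain :: "real \<Rightarrow> mcgehee set" where
  "ray_domain \<mu> = {s. position s \<in> noncoll \<mu> \<and> (0 < kinetic s \<or> mP\<phi> s < 0)}"

text \<open>The positive root \<open>k\<close> of \<open>k\<^sup>2 kinetic - k P\<^sub>\<phi> - (pot + c) = 0\<close>, written with the square
  root in the denominator because the leading coefficient may vanish, as it does for \<open>x = 0\<close> and
  \<open>P\<^sub>r = 0\<close>.\<close>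

definition level_scale :: "real \<Rightarrow> real \<Rightarrow> mcgehee \<Rightarrow> real" where
  "level_scale \<mu> c s = 2 * (pot \<mu> (position s) + c) /
     (sqrt ((mP\<phi> s)\<^sup>2 + 4 * kinetic s * (pot \<mu> (position s) + c)) - mP\<phi> s)"

definition scale_momentum :: "real \<Rightarrow> mcgehee \<Rightarrow> mcgehee" where
  "scale_momentum k s = (mx s, mz s, k * mPr s, k * mP\<phi> s)"

definition level_proj :: "real \<Rightarrow> real \<Rightarrow> mcgehee \<Rightarrow> mcgehee" where
  "level_proj \<mu> c s = scale_momentum (level_scale \<mu> c s) s"

lemma scale_momentum_proj [simp]:
  "mx (scale_momentum k s) = mx s" "mz (scale_momentum k s) = mz s" "mPr (scale_momentum k s)
    = k * mPr s"
  "mP\<phi> (scale_momentum k s) = k * mP\<phi> s" "scale_momentum 1 s = s"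
    "scale_momentum k (scale_momentum l s) = scale_momentum (k * l) s"
  by (simp_all add: scale_momentum_def) (cases s, simp)

lemma kinetic_nonneg: "0 \<le> kinetic s" by (simp add: kinetic_def)

lemma kinetic_scale_momentum: "kinetic (scale_momentum k s) = k\<^sup>2 * kinetic s"
  by (simp add: kinetic_def power_mult_distrib algebra_simps)

lemma scale_momentum_ray_domain: "0 < k \<Longrightarrow> scale_momentum k s \<in> ray_domain \<mu> \<longleftrightarrow> s \<in> ray_domain \<mu>"
  by (auto simp: ray_domain_def kinetic_scale_momentum zero_less_mult_iff mult_less_0_iff)

lemma hamiltonian_scale_momentum:
  "hamiltonian \<mu> (scale_momentum k s) = k\<^sup>2 * kinetic s - k * mP\<phi> s - pot \<mu> (position s)"
  by (simp add: hamiltonian_eq kinetic_def power_mult_distrib algebra_simps)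

lemma Cinf_on_kinetic: "open U \<Longrightarrow> Cinf_on U kinetic"
  unfolding kinetic_def[abs_def] by (intro Cinf_intros Cinf_on_mcgehee_proj) auto

lemma open_ray_domain: "open (ray_domain \<mu>)"
proof -
  have "continuous_on UNIV kinetic" by (intro Cinf_on_imp_continuous_on Cinf_on_kinetic) simp
  then show ?thesis unfolding ray_domain_def
    by (intro open_Collect_conj open_Collect_disj open_position_vimage open_Collect_less
      continuous_intros)
qed

context
  fixes \<mu> c :: real
  assumes \<mu>: "0 < \<mu>" "\<mu> < 1" and c: "0 < c"
begin

lemma pot_plus_pos: "0 < pot \<mu> y + c"
  using pot_nonneg[OF \<mu>, of y] c by linarith

lemma disc_pos: "s \<in> ray_domain \<mu> \<Longrightarrow> 0 < (mP\<phi> s)\<^sup>2 + 4 * kinetic s * (pot \<mu> (position s) + c)"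
proof -
  assume "s \<in> ray_domain \<mu>"
  then consider "0 < kinetic s" | "mP\<phi> s < 0" by (auto simp: ray_domain_def)
  then show ?thesis
    by cases (use pot_plus_pos[of "position s"] kinetic_nonneg[of s] in
        \<open>auto intro: add_nonneg_pos add_pos_nonneg\<close>)
qed

lemma den_pos:
  assumes "s \<in> ray_domain \<mu>"
  shows "0 < sqrt ((mP\<phi> s)\<^sup>2 + 4 * kinetic s * (pot \<mu> (position s) + c)) - mP\<phi> s"
proof (cases "mP\<phi> s < 0")
  case True
  have "0 \<le> sqrt ((mP\<phi> s)\<^sup>2 + 4 * kinetic s * (pot \<mu> (position s) + c))"
    using disc_pos[OF assms] by simp
  with True show ?thesis by linarith
next
  case False
  then have "0 < kinetic s * (pot \<mu> (position s) + c)"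
    using assms pot_plus_pos[of "position s"] by (simp add: ray_domain_def)
  then have "mP\<phi> s < sqrt ((mP\<phi> s)\<^sup>2 + 4 * kinetic s * (pot \<mu> (position s) + c))"
    by (intro real_less_rsqrt) simp
  then show ?thesis by simp
qed

lemma level_scale_pos: "s \<in> ray_domain \<mu> \<Longrightarrow> 0 < level_scale \<mu> c s"
  unfolding level_scale_def by (intro divide_pos_pos mult_pos_pos den_pos pot_plus_pos) simp_all

text \<open>The equation for the root is checked after multiplication by the square of its
  denominator \<open>R - P\<^sub>\<phi>\<close>, where \<open>R\<^sup>2\<close> is the discriminant.\<close>

lemma hamiltonian_level_proj:
  assumes "s \<in> ray_domain \<mu>"
  shows "hamiltonian \<mu> (level_proj \<mu> c s) = c"
proof -
  define G where "G = pot \<mu> (position s) + c"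
  define R where "R = sqrt ((mP\<phi> s)\<^sup>2 + 4 * kinetic s * G)"
  have R2: "R\<^sup>2 = (mP\<phi> s)\<^sup>2 + 4 * kinetic s * G"
    using disc_pos[OF assms] by (simp add: R_def G_def)
  have d: "R - mP\<phi> s > 0" using den_pos[OF assms] by (simp add: R_def G_def)
  have T: "level_scale \<mu> c s * (R - mP\<phi> s) = 2 * G"
    using d by (simp add: level_scale_def R_def G_def)
  have "(R - mP\<phi> s)\<^sup>2 * ((level_scale \<mu> c s)\<^sup>2 * kinetic s - level_scale \<mu> c s * mP\<phi> s - G)
    = kinetic s * (level_scale \<mu> c s * (R - mP\<phi> s))\<^sup>2
      - mP\<phi> s * (R - mP\<phi> s) * (level_scale \<mu> c s * (R - mP\<phi> s))
      - G * (R - mP\<phi> s)\<^sup>2"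
    by (simp add: power2_eq_square algebra_simps)
  also have "\<dots> = G * ((mP\<phi> s)\<^sup>2 + 4 * kinetic s * G - R\<^sup>2)"
    unfolding T by (simp add: power2_eq_square algebra_simps)
  also have "\<dots> = 0" by (simp add: R2)
  finally show ?thesis using d by (simp add: level_proj_def hamiltonian_scale_momentum G_def)
qed

lemma energy_level_ray_domain:
  assumes "position s \<in> noncoll \<mu>" "hamiltonian \<mu> s = c"
  shows "s \<in> ray_domain \<mu>"
proof -
  have "kinetic s - mP\<phi> s = pot \<mu> (position s) + c" using assms(2)
    by (simp add: hamiltonian_eq kinetic_def)
  then show ?thesis
    using pot_plus_pos[of "position s"] kinetic_nonneg[of s] assms(1) by (auto simp: ray_domain_def)
qed

text \<open>For energy \<open>c\<close> the discriminant is the square of \<open>P\<^sub>\<phi> + 2 (pot + c)\<close>.\<close>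

lemma level_scale_energy_level:
  assumes "hamiltonian \<mu> s = c"
  shows "level_scale \<mu> c s = 1"
proof -
  let ?G = "pot \<mu> (position s) + c"
  have k: "kinetic s = mP\<phi> s + ?G" using assms by (simp add: hamiltonian_eq kinetic_def field_simps)
  have "(mP\<phi> s)\<^sup>2 + 4 * kinetic s * ?G = (mP\<phi> s + 2 * ?G)\<^sup>2"
    unfolding k by (simp add: power2_eq_square algebra_simps)
  moreover have "0 \<le> kinetic s + ?G"
    by (intro add_nonneg_nonneg kinetic_nonneg less_imp_le pot_plus_pos)
  then have "0 \<le> mP\<phi> s + 2 * ?G" by (simp add: k)
  ultimately have "sqrt ((mP\<phi> s)\<^sup>2 + 4 * kinetic s * ?G) - mP\<phi> s = 2 * ?G"
    by simp
  then show ?thesis using pot_plus_pos[of "position s"] by (simp add: level_scale_def)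
qed

lemma level_proj_energy_level: "hamiltonian \<mu> s = c \<Longrightarrow> level_proj \<mu> c s = s"
  by (simp add: level_proj_def level_scale_energy_level)

lemma level_scale_scale_momentum:
  assumes "0 < k"
  shows "level_scale \<mu> c (scale_momentum k s) = level_scale \<mu> c s / k"
proof -
  let ?G = "pot \<mu> (position s) + c"
  have "(k * mP\<phi> s)\<^sup>2 + 4 * (k\<^sup>2 * kinetic s) * ?G = k\<^sup>2 * ((mP\<phi> s)\<^sup>2 + 4 * kinetic s * ?G)"
    by (simp add: power2_eq_square algebra_simps)
  then have "sqrt ((k * mP\<phi> s)\<^sup>2 + 4 * (k\<^sup>2 * kinetic s) * ?G) - k * mP\<phi> s
      = k * (sqrt ((mP\<phi> s)\<^sup>2 + 4 * kinetic s * ?G) - mP\<phi> s)"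
    using assms by (simp add: real_sqrt_mult right_diff_distrib)
  then show ?thesis by (simp add: level_scale_def kinetic_scale_momentum)
qed

lemma level_proj_scale_momentum: "0 < k \<Longrightarrow> level_proj \<mu> c (scale_momentum k s) = level_proj \<mu> c s"
  by (simp add: level_proj_def level_scale_scale_momentum)

lemma Cinf_on_level_scale: "Cinf_on (ray_domain \<mu>) (level_scale \<mu> c)"
proof -
  have pot: "Cinf_on (ray_domain \<mu>) (\<lambda>s. pot \<mu> (position s))"
    by (intro Cinf_intros Cinf_on_mcgehee_proj open_ray_domain Cinf_on_compose[OF Cinf_on_pot]
        open_noncoll) (auto simp: ray_domain_def)
  show ?thesis unfolding level_scale_def[abs_def]
    by (intro Cinf_intros Cinf_on_mcgehee_proj open_ray_domain pot Cinf_on_kinetic)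
      (use disc_pos in blast, use den_pos in force)
qed

lemma Cinf_on_level_proj: "Cinf_on (ray_domain \<mu>) (level_proj \<mu> c)"
  unfolding level_proj_def[abs_def] scale_momentum_def
  by (intro Cinf_intros Cinf_on_mcgehee_proj open_ray_domain Cinf_on_level_scale)

end

section \<open>Tangent spaces\<close>

lemma subspace_tangent_space: "subspace (tangent_space N p)"
  unfolding tangent_space_def by (rule subspace_span)

text \<open>A function that is constant on \<open>N\<close> is constant along all curves in \<open>N\<close>, so its
  derivative kills their initial velocities and hence the span of these.\<close>

lemma tangent_space_constraint:
  fixes F :: "'a::euclidean_space \<Rightarrow> real"
  assumes F: "(F has_derivative D) (at p)" and const: "\<And>q. q \<in> N \<Longrightarrow> F q = k"
    and v: "v \<in> tangent_space N p"
  shows "D v = 0"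
proof -
  let ?X = "{v. \<exists>\<gamma> \<epsilon>. 0 < \<epsilon> \<and> \<gamma> 0 = p \<and> (\<forall>t\<in>{0..<\<epsilon>}. \<gamma> t \<in> N) \<and>
      (\<gamma> has_vector_derivative v) (at 0 within {0..<\<epsilon>})}"
  have "D w = 0" if w: "w \<in> ?X" for w
  proof -
    obtain \<gamma> and \<epsilon> :: real where \<gamma>: "0 < \<epsilon>" "\<gamma> 0 = p" "\<And>t. t \<in> {0..<\<epsilon>} \<Longrightarrow> \<gamma> t \<in> N"
      "(\<gamma> has_vector_derivative w) (at 0 within {0..<\<epsilon>})"
      using w by blast
    have "(F has_derivative D) (at (\<gamma> 0) within \<gamma> ` {0..<\<epsilon>})"
      using F \<gamma>(2) has_derivative_at_withinI by blast
    from vector_derivative_diff_chain_within[OF \<gamma>(4) this]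
    have "((\<lambda>t. k) has_vector_derivative D w) (at 0 within {0..<\<epsilon>})"
      by (rule has_vector_derivative_transform_within[OF _ \<gamma>(1)]) (use \<gamma>(1,3) const in auto)
    moreover have "at 0 within {0..<\<epsilon>} \<noteq> bot"
      using islimpt_subset[OF islimpt_greaterThanLessThan1[OF \<gamma>(1)], of "{0..<\<epsilon>}"]
      by (simp add: trivial_limit_within subset_eq)
    ultimately show ?thesis
      using vector_derivative_unique_within has_vector_derivative_const by blast
  qed
  moreover have "subspace {v. D v = 0}"
    by (rule linear_subspace_kernel) (use F has_derivative_linear in blast)
  ultimately have "span ?X \<subseteq> {v. D v = 0}"
    by (intro span_minimal) auto
  then show ?thesis using v unfolding tangent_space_def by blast
qed

text \<open>Lets two-sided derivatives produce tangent vectors, although the curve needs to stay in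
  \<open>N\<close> for small positive times only.\<close>

lemma tangent_spaceI:
  assumes "(\<gamma> has_vector_derivative v) (at 0)" "\<gamma> 0 = p" "p \<in> N" "\<forall>\<^sub>F t in at_right 0. \<gamma> t \<in> N"
  shows "v \<in> tangent_space N p"
proof -
  obtain \<epsilon> :: real where \<epsilon>: "0 < \<epsilon>" "\<And>t. 0 < t \<Longrightarrow> t < \<epsilon> \<Longrightarrow> \<gamma> t \<in> N"
    using assms(4) unfolding eventually_at_right_field by blast
  have "\<gamma> t \<in> N" if "t \<in> {0..<\<epsilon>}" for t
    using that \<epsilon>(2)[of t] assms(2,3) by (cases "t = 0") auto
  moreover have "(\<gamma> has_vector_derivative v) (at 0 within {0..<\<epsilon>})"
    using assms(1) has_vector_derivative_at_within by blast
  ultimately show ?thesis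
    unfolding tangent_space_def using \<epsilon>(1) assms(2) by (intro span_base) blast
qed

text \<open>A curve through \<open>s\<close> that stays on the circle \<open>\<bar>z\<bar> = 1\<close> and has velocity \<open>v\<close> if \<open>v\<close> is
  tangent to it.\<close>

definition test_curve :: "mcgehee \<Rightarrow> mcgehee \<Rightarrow> real \<Rightarrow> mcgehee" where
  "test_curve s v t = (mx s + t * mx v, mz s * cis (t * ang s v), mPr s + t * mPr v, mP\<phi> s
    + t * mP\<phi> v)"

lemma ang_tangent:
  assumes "cmod (mz s) = 1" "mz s \<bullet> mz v = 0"
  shows "mz v = mz s * (\<i> * of_real (ang s v))"
proof -
  have z: "mz s * cnj (mz s) = 1" using assms(1) by (simp add: complex_norm_square[symmetric])
  then have "mz v / mz s = mz v * cnj (mz s)"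
    by (metis div_by_0 divide_eq_eq mult.assoc mult.commute mult_cancel_left1 mult_zero_left
      nonzero_mult_div_cancel_left)
  moreover have "Re (mz v * cnj (mz s)) = 0"
    using assms(2) by (simp add: inner_complex_def algebra_simps)
  ultimately have "mz v / mz s = \<i> * of_real (ang s v)"
    by (simp add: ang_def complex_eq_iff)
  moreover have "mz s \<noteq> 0" using z by auto
  ultimately show ?thesis by (simp add: field_simps)
qed

lemma test_curve_0 [simp]: "test_curve s v 0 = s"
  by (cases s) (simp add: test_curve_def)

lemma test_curve_has_vector_derivative:
  assumes "cmod (mz s) = 1" "mz s \<bullet> mz v = 0"
  shows "(test_curve s v has_vector_derivative v) (at 0)"
proof -
  have "((\<lambda>t. (mx s + t * mx v, mz s * cis (t * ang s v), mPr s + t * mPr v, mP\<phi> s + t * mP\<phi> v))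
    has_derivative (\<lambda>t. (t * mx v, mz s * (t * ang s v) *\<^sub>R (\<i> * cis (0 * ang s v)),
      t * mPr v, t * mP\<phi> v))) (at 0)"
    by (intro has_derivative_Pair has_derivative_mult_right has_derivative_cis)
      (auto intro!: derivative_eq_intros)
  moreover have "(t * mx v, mz s * (t * ang s v) *\<^sub>R (\<i> * cis (0 * ang s v)), t * mPr v, t * mP\<phi> v)
    = t *\<^sub>R v" for t
    by (rule mcgehee_eqI) (simp_all add: ang_tangent[OF assms] scaleR_conv_of_real algebra_simps)
  ultimately show ?thesis
    by (simp add: has_vector_derivative_def test_curve_def[abs_def])
qed

lemma test_curve_tendsto:
  assumes "cmod (mz s) = 1" "mz s \<bullet> mz v = 0" "open U" "s \<in> U"
  shows "\<forall>\<^sub>F t in at_right 0. test_curve s v t \<in> U"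
proof -
  have "isCont (test_curve s v) 0"
    using test_curve_has_vector_derivative[OF assms(1,2)] has_vector_derivative_continuous by blast
  then have "\<forall>\<^sub>F t in at 0. test_curve s v t \<in> U"
    unfolding isCont_def using assms(3,4) by (metis test_curve_0 topological_tendstoD)
  then show ?thesis by (simp add: eventually_at_split)
qed

lemma test_curve_phase_space:
  assumes "s \<in> phase_space \<mu>" "mz s \<bullet> mz v = 0" "0 < mx s \<or> 0 \<le> mx v"
  shows "\<forall>\<^sub>F t in at_right 0. test_curve s v t \<in> phase_space \<mu>"
proof -
  note s = assms(1)[unfolded phase_space_iff]
  have "\<forall>\<^sub>F t in at_right 0. position (test_curve s v t) \<in> noncoll \<mu>"
    using test_curve_tendsto[of s v, OF _ assms(2) open_position_vimage] s by simp
  moreover have "\<forall>\<^sub>F t in at_right 0. 0 \<le> mx (test_curve s v t)"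
  proof (cases "0 < mx s")
    case True
    have "open {s. 0 < mx s}" by (intro open_Collect_less continuous_intros)
    from test_curve_tendsto[OF _ assms(2) this] s True show ?thesis
      by (auto elim: eventually_mono)
  next
    case False
    then show ?thesis
      using s assms(3) by (auto simp: test_curve_def eventually_at_right_field intro!: exI[of _ 1])
  qed
  ultimately show ?thesis
    by eventually_elim (use s in \<open>simp add: phase_space_iff test_curve_def norm_mult\<close>)
qed

lemma circle_constraint:
  assumes "\<And>q. q \<in> N \<Longrightarrow> cmod (mz q) = 1" "v \<in> tangent_space N s"
  shows "mz s \<bullet> mz v = 0"
proof -
  have "((\<lambda>q. mz q \<bullet> mz q) has_derivative (\<lambda>v. mz s \<bullet> mz v + mz v \<bullet> mz s)) (at s)"
    by (intro has_derivative_inner mcgehee_proj_has_derivative_at)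
  from tangent_space_constraint[OF this _ assms(2), of 1] assms(1) show ?thesis
    by (simp add: dot_square_norm inner_commute)
qed

text \<open>At \<open>x = 0\<close> only half of the tangent vectors are velocities; the others are their negatives.\<close>

lemma tangent_space_half:
  assumes "\<And>v. v \<in> S \<Longrightarrow> 0 < mx s \<or> 0 \<le> mx v \<Longrightarrow> v \<in> tangent_space N s" "subspace S" "v \<in> S"
  shows "v \<in> tangent_space N s"
proof (cases "0 \<le> mx v")
  case False
  then have "- v \<in> tangent_space N s"
    using assms mcgehee_proj_linear(1)[THEN linear_neg] by (auto simp: subspace_neg)
  then show ?thesis using subspace_neg[OF subspace_tangent_space] by fastforce
qed (use assms in auto)

text \<open>The angular motion of \<open>test_curve\<close> preserves \<open>\<bar>z\<bar> = 1\<close>, and the other constraints are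
  open or hold for small positive times.\<close>

lemma tangent_space_phase_space:
  assumes "s \<in> phase_space \<mu>"
  shows "tangent_space (phase_space \<mu>) s = {v. mz s \<bullet> mz v = 0}"
proof (intro equalityI subsetI)
  fix v assume "v \<in> tangent_space (phase_space \<mu>) s"
  then show "v \<in> {v. mz s \<bullet> mz v = 0}"
    using circle_constraint[of "phase_space \<mu>" v s] by (auto simp: phase_space_iff)
next
  fix v assume v: "v \<in> {v. mz s \<bullet> mz v = 0}"
  have "w \<in> tangent_space (phase_space \<mu>) s" if "w \<in> {v. mz s \<bullet> mz v = 0}" "0 < mx s \<or> 0 \<le> mx w"
    for w
    using that assms by (intro tangent_spaceI[OF test_curve_has_vector_derivative]
      test_curve_phase_space)
      (auto simp: phase_space_iff)
  moreover have "subspace {v. mz s \<bullet> mz v = 0}" by (auto simp: subspace_def inner_add_right)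
  ultimately show "v \<in> tangent_space (phase_space \<mu>) s" using tangent_space_half v by blast
qed

text \<open>Kernel vectors of \<open>dH\<close> are velocities: project the curve of the phase space with
  velocity \<open>w\<close> to the level. The new velocity differs from \<open>w\<close> by a multiple of \<open>Y\<close>, which must be
  zero as both lie in the kernel of \<open>dH\<close> and \<open>dH(Y) \<noteq> 0\<close>.\<close>

lemma tangent_space_energy_level:
  assumes \<mu>: "0 < \<mu>" "\<mu> < 1" and c: "0 < c" and s: "s \<in> energy_level \<mu> c"
  shows "tangent_space (energy_level \<mu> c) s = {v. mz s \<bullet> mz v = 0 \<and> dH \<mu> s v = 0}"
proof -
  have s': "0 \<le> mx s" "cmod (mz s) = 1" "position s \<in> noncoll \<mu>" "hamiltonian \<mu> s = c"
    "s \<in> phase_space \<mu>" and ray_domain: "s \<in> ray_domain \<mu>"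
    using s energy_level_ray_domain[OF \<mu> c] by (auto simp: energy_level_iff phase_space_iff)
  have sub: "mz s \<bullet> mz v = 0 \<and> dH \<mu> s v = 0" if v: "v \<in> tangent_space (energy_level \<mu> c) s" for v
    using circle_constraint[OF _ v] tangent_space_constraint[OF hamiltonian_has_derivative[OF s'(3)]
      _ v, of c]
    by (auto simp: energy_level_iff)
  have "w \<in> tangent_space (energy_level \<mu> c) s"
    if w: "w \<in> {v. mz s \<bullet> mz v = 0 \<and> dH \<mu> s v = 0}" "0 < mx s \<or> 0 \<le> mx w" for w
  proof -
    let ?\<delta> = "\<lambda>t. level_proj \<mu> c (test_curve s w t)"
    obtain D where D: "(level_scale \<mu> c has_derivative D) (at s)"
      using Cinf_on_has_derivative[OF Cinf_on_level_scale[OF \<mu> c] ray_domain] by blast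
    have "(level_proj \<mu> c has_derivative
       (\<lambda>v. (mx v, mz v, level_scale \<mu> c s * mPr v + D v * mPr s, level_scale \<mu> c s * mP\<phi> v
         + D v * mP\<phi> s))) (at s)"
      unfolding level_proj_def[abs_def] scale_momentum_def
      by (intro has_derivative_Pair has_derivative_mult D mcgehee_proj_has_derivative_at)
    moreover have "(mx v, mz v, level_scale \<mu> c s * mPr v + D v * mPr s, level_scale \<mu> c s * mP\<phi> v
      + D v * mP\<phi> s)
      = v + D v *\<^sub>R Y_field s" for v
      by (rule mcgehee_eqI) (simp_all add: level_scale_energy_level[OF \<mu> c s'(4)])
    ultimately have "(level_proj \<mu> c has_derivative (\<lambda>v. v + D v *\<^sub>R Y_field s))
      (at (test_curve s w 0))" by simp
    from vector_derivative_diff_chain_within[OF test_curve_has_vector_derivative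
      has_derivative_at_withinI[OF this]]
    have der: "(?\<delta> has_vector_derivative w + D w *\<^sub>R Y_field s) (at 0)"
      using w s' by (simp add: o_def)
    have "\<forall>\<^sub>F t in at_right 0. test_curve s w t \<in> phase_space \<mu>"
      "\<forall>\<^sub>F t in at_right 0. test_curve s w t \<in> ray_domain \<mu>"
      using test_curve_phase_space[of s \<mu> w] test_curve_tendsto[of s w, OF _ _ open_ray_domain] w s'
        ray_domain by auto
    then have "\<forall>\<^sub>F t in at_right 0. ?\<delta> t \<in> energy_level \<mu> c"
      by eventually_elim (auto simp: energy_level_iff phase_space_iff
        hamiltonian_level_proj[OF \<mu> c],
          simp_all add: level_proj_def)
    with der s have T: "w + D w *\<^sub>R Y_field s \<in> tangent_space (energy_level \<mu> c) s"
      by (intro tangent_spaceI[where \<gamma> = ?\<delta>]) (simp_all add: level_proj_energy_level[OF \<mu> c s'(4)])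
    from sub[OF T] w have "D w * YH s = 0"
      by (simp add: dH_linear_simps[OF s'(3)] dH_Y_field[OF s'(3)])
    then have "D w = 0" using YH_pos[OF \<mu>, of s] s' c by simp
    with T show ?thesis by simp
  qed
  moreover have "subspace {v. mz s \<bullet> mz v = 0 \<and> dH \<mu> s v = 0}"
    using dH_linear_simps[OF s'(3)] linear_0[OF
      bounded_linear.linear[OF dH_bounded_linear[OF s'(3)]]]
    by (auto simp: subspace_def inner_add_right)
  ultimately show ?thesis using sub tangent_space_half by blast
qed

lemma transverse_energy_level:
  assumes \<mu>: "0 < \<mu>" "\<mu> < 1" and c: "0 < c"
  shows "transverse_to (phase_space \<mu>) (energy_level \<mu> c) Y_field"
  unfolding transverse_to_def
proof (intro ballI conjI)
  fix s assume s: "s \<in> energy_level \<mu> c"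
  let ?T = "tangent_space (energy_level \<mu> c) s" and ?W = "tangent_space (phase_space \<mu>) s"
  have W: "s \<in> phase_space \<mu>" and pos: "position s \<in> noncoll \<mu>"
    using s by (auto simp: energy_level_def phase_space_iff)
  have YH: "0 < YH s" using YH_pos[OF \<mu>] s c by (simp add: energy_level_def)
  show "Y_field s \<notin> ?T"
    using YH by (simp add: tangent_space_energy_level[OF \<mu> c s] dH_Y_field[OF pos])
  have "?T \<subseteq> ?W" "Y_field s \<in> ?W"
    by (auto simp: tangent_space_energy_level[OF \<mu> c s] tangent_space_phase_space[OF W])
  moreover have "v \<in> span (insert (Y_field s) ?T)" if "v \<in> ?W" for v
  proof -
    have "v - (dH \<mu> s v / YH s) *\<^sub>R Y_field s \<in> ?T"
      using that YH by (simp add: tangent_space_energy_level[OF \<mu> c s]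
          tangent_space_phase_space[OF W] dH_linear_simps[OF pos] dH_Y_field[OF pos])
    then show ?thesis by (auto simp: span_insert intro!: exI span_base)
  qed
  ultimately show "span (insert (Y_field s) ?T) = ?W"
    by (intro equalityI span_minimal subspace_tangent_space) auto
qed

section \<open>Charts\<close>

text \<open>The relatively open sets of the definition arise as traces of \<open>U\<close> on the half space and
  of \<open>V\<close> on \<open>N\<close>, between which \<open>f\<close> and \<open>g\<close> are mutually inverse. One model half space serves for
  all points.\<close>

lemma manifold_with_boundaryI:
  fixes N B :: "'a::euclidean_space set"
  assumes "B \<subseteq> N"
    and "\<And>p. p \<in> N \<Longrightarrow> \<exists>U V (f :: 'a \<Rightarrow> 'a) (g :: 'a \<Rightarrow> 'a).
      open U \<and> open V \<and> p \<in> V \<and> Cinf_on U f \<and> Cinf_on V g \<and>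
      (\<forall>y\<in>U \<inter> S. 0 \<le> y \<bullet> e \<longrightarrow> f y \<in> N \<inter> V \<and> g (f y) = y \<and> (f y \<in> B \<longleftrightarrow> y \<bullet> e = 0)) \<and>
      (\<forall>q\<in>N \<inter> V. g q \<in> U \<inter> S \<and> 0 \<le> g q \<bullet> e \<and> f (g q) = q)"
    and "subspace S" "dim S = d" "e \<in> S" "e \<noteq> 0"
  shows "manifold_with_boundary d N B"
  unfolding manifold_with_boundary_def
proof (intro conjI ballI)
  fix p assume "p \<in> N"
  from assms(2)[OF this] obtain U V and f g :: "'a \<Rightarrow> 'a" where UV: "open U" "open V" "p \<in> V"
      "Cinf_on U f" "Cinf_on V g"
    and f: "\<And>y. y \<in> U \<Longrightarrow> y \<in> S \<Longrightarrow> 0 \<le> y \<bullet> e \<Longrightarrow>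
        f y \<in> N \<inter> V \<and> g (f y) = y \<and> (f y \<in> B \<longleftrightarrow> y \<bullet> e = 0)"
    and g: "\<And>q. q \<in> N \<Longrightarrow> q \<in> V \<Longrightarrow> g q \<in> U \<inter> S \<and> 0 \<le> g q \<bullet> e \<and> f (g q) = q"
    by (metis IntI)
  define \<Omega> where "\<Omega> = {y \<in> S. 0 \<le> y \<bullet> e} \<inter> U"
  have im: "f ` \<Omega> = N \<inter> V"
  proof (intro equalityI subsetI)
    fix q assume "q \<in> N \<inter> V"
    then show "q \<in> f ` \<Omega>" using g[of q] by (intro image_eqI[of _ _ "g q"]) (auto simp: \<Omega>_def)
  qed (use f in \<open>auto simp: \<Omega>_def\<close>)
  show "\<exists>S e \<Omega> (f :: 'a \<Rightarrow> 'a) (g :: 'a \<Rightarrow> 'a).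
        subspace S \<and> dim S = d \<and> e \<in> S \<and> e \<noteq> 0 \<and>
        openin (top_of_set {y \<in> S. 0 \<le> y \<bullet> e}) \<Omega> \<and>
        p \<in> f ` \<Omega> \<and> openin (top_of_set N) (f ` \<Omega>) \<and>
        smooth_on \<Omega> f \<and> smooth_on (f ` \<Omega>) g \<and> (\<forall>y\<in>\<Omega>. g (f y) = y) \<and>
        (\<forall>y\<in>\<Omega>. f y \<in> B \<longleftrightarrow> y \<bullet> e = 0)"
  proof (rule exI[of _ S], rule exI[of _ e], rule exI[of _ \<Omega>], rule exI[of _ f], rule exI[of _ g],
      intro conjI assms(3-6))
    show "openin (top_of_set {y \<in> S. 0 \<le> y \<bullet> e}) \<Omega>"
      unfolding \<Omega>_def using UV(1) by (rule openin_open_Int)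
    show "openin (top_of_set N) (f ` \<Omega>)" unfolding im using UV(2) by (rule openin_open_Int)
    show "p \<in> f ` \<Omega>" unfolding im using \<open>p \<in> N\<close> UV(3) by simp
    show "smooth_on \<Omega> f" by (rule smooth_onI[OF UV(1) _ UV(4)]) (simp add: \<Omega>_def)
    show "smooth_on (f ` \<Omega>) g" unfolding im by (rule smooth_onI[OF UV(2) _ UV(5)]) simp
  qed (use f in \<open>auto simp: \<Omega>_def\<close>)
qed (rule assms(1))

text \<open>The circle near \<open>z\<close> is parametrised by central projection from its tangent line at \<open>z\<close>.
  Then the inverse \<open>slope\<close> is rational and does not change along rays, so it serves for the
  direction of the momentum as well.\<close>

definition arcpt :: "complex \<Rightarrow> real \<Rightarrow> complex" where
  "arcpt z a = z * (of_real (1 / sqrt (1 + a\<^sup>2)) * (1 + \<i> * of_real a))"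

definition slope :: "complex \<Rightarrow> complex \<Rightarrow> real" where
  "slope z w = Im (cnj z * w) / Re (cnj z * w)"

lemma cnj_mult_self: "cnj z * z = of_real ((cmod z)\<^sup>2)"
  by (simp only: complex_norm_square mult.commute)

lemma Re_cnj_mult_self_pos: "z \<noteq> 0 \<Longrightarrow> 0 < Re (cnj z * z)"
  unfolding cnj_mult_self by simp

lemma one_plus_square_pos: "0 < 1 + (a::real)\<^sup>2"
  by (simp add: add_pos_nonneg)

lemma cnj_mult_arcpt:
  assumes "cmod z = 1"
  shows "cnj z * arcpt z a = of_real (1 / sqrt (1 + a\<^sup>2)) * (1 + \<i> * of_real a)"
proof -
  have "cnj z * z = 1" using assms by (simp add: complex_norm_square[symmetric] mult.commute)
  then show ?thesis by (simp add: arcpt_def flip: mult.assoc)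
qed

lemma norm_arcpt: "cmod z = 1 \<Longrightarrow> cmod (arcpt z a) = 1"
proof -
  have "cmod (1 + \<i> * of_real a) = sqrt (1 + a\<^sup>2)" by (simp add: cmod_def)
  moreover assume "cmod z = 1"
  ultimately show ?thesis
    using one_plus_square_pos[of a] unfolding arcpt_def norm_mult norm_of_real by simp
qed

lemma Re_cnj_mult_arcpt: "cmod z = 1 \<Longrightarrow> 0 < Re (cnj z * arcpt z a)"
  using one_plus_square_pos[of a] by (simp add: cnj_mult_arcpt)

lemma slope_arcpt: "cmod z = 1 \<Longrightarrow> slope z (arcpt z a) = a"
  using one_plus_square_pos[of a] by (simp add: slope_def cnj_mult_arcpt)

lemma slope_of_real_mult: "k \<noteq> 0 \<Longrightarrow> slope z (of_real k * w) = slope z w"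
  by (simp add: slope_def mult.left_commute[of "cnj z"])

lemma slope_line: "z \<noteq> 0 \<Longrightarrow> slope z (z * (1 + \<i> * of_real a)) = a"
  by (simp add: slope_def complex_norm_square[symmetric] mult.assoc[symmetric]
    mult.commute[of "cnj z" z])

lemma one_plus_slope:
  assumes "0 < Re (cnj z * w)"
  shows "z * (1 + \<i> * of_real (slope z w)) = of_real ((cmod z)\<^sup>2 / Re (cnj z * w)) * w"
proof -
  let ?u = "cnj z * w"
  have "1 + \<i> * of_real (slope z w) = ?u / of_real (Re ?u)"
    using assms by (simp add: complex_eq_iff slope_def Re_divide_of_real Im_divide_of_real)
  then have "z * (1 + \<i> * of_real (slope z w)) = (z * cnj z) * w / of_real (Re ?u)"
    by (simp add: mult.assoc)
  then show ?thesis by (simp add: complex_norm_square[symmetric])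
qed

lemma arcpt_slope:
  assumes "cmod z = 1" "cmod w = 1" "0 < Re (cnj z * w)"
  shows "arcpt z (slope z w) = w"
proof -
  let ?u = "cnj z * w"
  have "(Re ?u)\<^sup>2 + (Im ?u)\<^sup>2 = 1"
    using assms cmod_power2[of ?u] by (simp add: norm_mult)
  then have "1 + (slope z w)\<^sup>2 = (1 / Re ?u)\<^sup>2"
    using assms(3) by (simp add: slope_def power_divide add_divide_distrib[symmetric] field_simps)
  then have "sqrt (1 + (slope z w)\<^sup>2) = 1 / Re ?u"
    using assms(3) by (simp only: real_sqrt_abs) simp
  then have "arcpt z (slope z w) = of_real (Re ?u) * (z * (1 + \<i> * of_real (slope z w)))"
    by (simp add: arcpt_def)
  also have "\<dots> = w"
    unfolding one_plus_slope[OF assms(3)] mult.assoc[symmetric] of_real_mult[symmetric]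
    using assms(1,3) by (simp del: times_complex.sel)
  finally show ?thesis .
qed

lemma Cinf_on_arcpt: "open U \<Longrightarrow> Cinf_on U f \<Longrightarrow> Cinf_on U (\<lambda>s. arcpt z (f s))"
  unfolding arcpt_def using one_plus_square_pos
  by (intro Cinf_intros) (auto simp: less_imp_neq[symmetric] order_less_imp_not_eq2)

lemma Cinf_on_slope:
  "open U \<Longrightarrow> Cinf_on U f \<Longrightarrow> (\<And>s. s \<in> U \<Longrightarrow> 0 < Re (cnj z * f s)) \<Longrightarrow> Cinf_on U (\<lambda>s. slope z (f s))"
  unfolding slope_def by (intro Cinf_intros) (auto dest: order_less_imp_not_eq2)

text \<open>Half spaces for the charts: the angle uses the imaginary axis of the complex factor, and
  \<open>b\<close> provides the momentum directions.\<close>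

definition model_space :: "mcgehee set \<Rightarrow> mcgehee set" where
  "model_space b = {y. \<forall>i\<in>Basis. i \<notin> insert (1, 0, 0, 0) (insert (0, \<i>, 0, 0) b) \<longrightarrow> y \<bullet> i = 0}"

lemma model_space_3: "y \<in> model_space {(0, 0, 1, 0)} \<longleftrightarrow> Re (mz y) = 0 \<and> mP\<phi> y = 0"
  by (cases y) (auto simp: model_space_def Basis_prod_def Basis_complex_def zero_prod_def
    inner_complex_def)

lemma model_space_4: "y \<in> model_space {(0, 0, 1, 0), (0, 0, 0, 1)} \<longleftrightarrow> Re (mz y) = 0"
  by (cases y) (auto simp: model_space_def Basis_prod_def Basis_complex_def zero_prod_def
    inner_complex_def)

lemma subspace_model_space: "subspace (model_space b)"
  by (auto simp: model_space_def subspace_def inner_add_left)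

lemma dim_model_space:
  "dim (model_space {(0, 0, 1, 0)}) = 3" "dim (model_space {(0, 0, 1, 0), (0, 0, 0, 1)}) = 4"
  unfolding model_space_def
  by (subst dim_substandard; auto simp: Basis_prod_def Basis_complex_def zero_prod_def)+

lemma inner_e: "y \<bullet> (1, 0, 0, 0) = mx y"
  by (cases y) simp

lemma manifold_phase_space:
  "manifold_with_boundary 4 (phase_space \<mu>) (crit_set (phase_space \<mu>) mx)"
proof (rule manifold_with_boundaryI[where e = "(1, 0, 0, 0)"])
  let ?S = "model_space {(0, 0, 1, 0), (0, 0, 0, 1)}"
  fix p assume p: "p \<in> phase_space \<mu>"
  define z0 where "z0 = mz p"
  have z0: "cmod z0 = 1" using p by (simp add: z0_def phase_space_iff)
  define f :: "mcgehee \<Rightarrow> mcgehee" where "f y = (mx y, arcpt z0 (Im (mz y)), mPr y, mP\<phi> y)" for y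
  define g :: "mcgehee \<Rightarrow> mcgehee" where "g q = (mx q, \<i> * of_real (slope z0 (mz q)), mPr q, mP\<phi> q)"
    for q
  define U where "U = {y. position (f y) \<in> noncoll \<mu>}"
  define V where "V = {q. 0 < Re (cnj z0 * mz q)}"
  have f: "Cinf_on W f" if "open W" for W
    unfolding f_def using that by (intro Cinf_intros Cinf_on_mcgehee_proj Cinf_on_arcpt)
  have U: "open U"
    using open_vimage[OF open_position_vimage Cinf_on_imp_continuous_on[OF f[OF open_UNIV]]]
    by (simp add: U_def vimage_def)
  have V: "open V" unfolding V_def by (intro open_Collect_less continuous_intros)
  have g: "Cinf_on V g"
    unfolding g_def using V by (intro Cinf_intros Cinf_on_mcgehee_proj Cinf_on_slope)
      (simp_all add: V_def)
  have "f y \<in> phase_space \<mu> \<inter> V \<and> g (f y) = y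
    \<and> (f y \<in> crit_set (phase_space \<mu>) mx \<longleftrightarrow> y \<bullet> (1, 0, 0, 0) = 0)"
    if "y \<in> U \<inter> ?S" "0 \<le> y \<bullet> (1, 0, 0, 0)" for y
  proof -
    have N: "f y \<in> phase_space \<mu>"
      using that by (simp add: phase_space_iff f_def U_def inner_e norm_arcpt[OF z0])
    moreover have "f y \<in> V"
      using Re_cnj_mult_arcpt[OF z0] by (simp add: f_def V_def)
    moreover have "g (f y) = y"
      using that by (intro mcgehee_eqI) (simp_all add: g_def f_def slope_arcpt[OF z0] model_space_4
        complex_eq_iff)
    ultimately show ?thesis by (simp add: crit_set_def inner_e) (simp add: f_def)
  qed
  moreover have "g q \<in> U \<inter> ?S \<and> 0 \<le> g q \<bullet> (1, 0, 0, 0) \<and> f (g q) = q" if "q \<in> phase_space \<mu> \<inter> V"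
    for q
  proof -
    have "f (g q) = q"
      using that by (intro mcgehee_eqI) (simp_all add: f_def g_def V_def phase_space_iff
        arcpt_slope[OF z0])
    then show ?thesis
      using that by (simp add: U_def inner_e model_space_4 phase_space_iff) (simp add: g_def)
  qed
  moreover have "p \<in> V"
    using z0 Re_cnj_mult_self_pos[of z0] by (fastforce simp: V_def z0_def)
  ultimately show "\<exists>U V f g. open U \<and> open V \<and> p \<in> V \<and> Cinf_on U f \<and> Cinf_on V g \<and>
      (\<forall>y\<in>U \<inter> ?S. 0 \<le> y \<bullet> (1, 0, 0, 0) \<longrightarrow> f y \<in> phase_space \<mu> \<inter> V \<and> g (f y) = y \<and>
        (f y \<in> crit_set (phase_space \<mu>) mx \<longleftrightarrow> y \<bullet> (1, 0, 0, 0) = 0)) \<and>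
      (\<forall>q\<in>phase_space \<mu> \<inter> V. g q \<in> U \<inter> ?S \<and> 0 \<le> g q \<bullet> (1, 0, 0, 0) \<and> f (g q) = q)"
    using U V f[OF U] g by blast
qed (auto simp: subspace_model_space dim_model_space model_space_4 crit_set_def zero_prod_def)

definition momentum :: "mcgehee \<Rightarrow> complex" where "momentum s = Complex (mPr s) (mP\<phi> s)"

lemma momentum_eq: "momentum s = of_real (mPr s) + \<i> * of_real (mP\<phi> s)"
  by (simp add: momentum_def complex_eq_iff)

lemma momentum_scale_momentum: "momentum (scale_momentum k s) = of_real k * momentum s"
  by (simp add: momentum_eq algebra_simps)

text \<open>A chart consists of \<open>x\<close>, the angle of the position and the direction of the momentum;
  the length of the momentum is recovered by \<open>level_proj\<close>.\<close>

lemma manifold_energy_level: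
  assumes \<mu>: "0 < \<mu>" "\<mu> < 1" and c: "0 < c"
  shows "manifold_with_boundary 3 (energy_level \<mu> c) (crit_set (energy_level \<mu> c) mx)"
proof (rule manifold_with_boundaryI[where e = "(1, 0, 0, 0)"])
  let ?S = "model_space {(0, 0, 1, 0)}"
  fix p assume p: "p \<in> energy_level \<mu> c"
  define z0 where "z0 = mz p"
  define w0 where "w0 = momentum p"
  have z0: "cmod z0 = 1" using p by (simp add: z0_def energy_level_iff)
  have w0: "w0 \<noteq> 0"
    using p YH_pos[OF \<mu>, of p] c by (auto simp: w0_def momentum_def energy_level_iff YH_def
      complex_eq_iff)
  (* The momentum of h y runs through the line tangent at w0 to the circle about 0, so it is
     transverse to the rays. *)
  define h :: "mcgehee \<Rightarrow> mcgehee" where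
    "h y = (mx y, arcpt z0 (Im (mz y)), Re (w0 * (1 + \<i> * of_real (mPr y))), Im
      (w0 * (1 + \<i> * of_real (mPr y))))" for y
  define f where "f y = level_proj \<mu> c (h y)" for y
  define g :: "mcgehee \<Rightarrow> mcgehee" where
    "g q = (mx q, \<i> * of_real (slope z0 (mz q)), slope w0 (momentum q), 0)" for q
  define U where "U = {y. h y \<in> ray_domain \<mu>}"
  define V where "V = {q. 0 < Re (cnj z0 * mz q)} \<inter> {q. 0 < Re (cnj w0 * momentum q)}"
  have h: "Cinf_on W h" if "open W" for W
    unfolding h_def using that by (intro Cinf_intros Cinf_on_mcgehee_proj Cinf_on_arcpt)
  have U: "open U"
    using open_vimage[OF open_ray_domain Cinf_on_imp_continuous_on[OF h[OF open_UNIV]]]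
    by (simp add: U_def vimage_def)
  have f: "Cinf_on U f"
    unfolding f_def by (rule Cinf_on_compose[OF Cinf_on_level_proj[OF \<mu> c] U open_ray_domain
      h[OF U]]) (simp add: U_def)
  have V: "open V" unfolding V_def momentum_eq
    by (intro open_Int open_Collect_less continuous_intros)
  have g: "Cinf_on V g"
    unfolding g_def momentum_eq using V
    by (intro Cinf_intros Cinf_on_mcgehee_proj Cinf_on_slope) (simp_all add: V_def momentum_eq)
  have momentum_h: "momentum (h y) = w0 * (1 + \<i> * of_real (mPr y))" for y
    by (simp add: momentum_def h_def complex_eq_iff)
  have "f y \<in> energy_level \<mu> c \<inter> V \<and> g (f y) = y
    \<and> (f y \<in> crit_set (energy_level \<mu> c) mx \<longleftrightarrow> y \<bullet> (1, 0, 0, 0) = 0)"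
    if y: "y \<in> U \<inter> ?S" "0 \<le> y \<bullet> (1, 0, 0, 0)" for y
  proof -
    have hy: "h y \<in> ray_domain \<mu>" using y by (simp add: U_def)
    let ?k = "level_scale \<mu> c (h y)"
    have k: "0 < ?k" by (rule level_scale_pos[OF \<mu> c hy])
    have pf: "mx (f y) = mx y" "mz (f y) = arcpt z0 (Im (mz y))" "momentum (f y)
      = of_real ?k * (w0 * (1 + \<i> * of_real (mPr y)))"
      by (simp_all add: f_def level_proj_def momentum_scale_momentum momentum_h)
        (simp_all add: h_def)
    have N: "f y \<in> energy_level \<mu> c"
      using y hy hamiltonian_level_proj[OF \<mu> c hy]
      by (simp add: energy_level_iff inner_e norm_arcpt[OF z0] pf)
        (simp add: f_def h_def ray_domain_def)
    moreover have "cnj w0 * momentum (f y) = of_real (?k * (cmod w0)\<^sup>2) * (1 + \<i> * of_real (mPr y))"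
      using cnj_mult_self[of w0] by (simp add: pf)
    from arg_cong[OF this, of Re] have re: "Re (cnj w0 * momentum (f y)) = ?k * (cmod w0)\<^sup>2" by simp
    then have "0 < Re (cnj w0 * momentum (f y))"
      unfolding re using k w0 by simp
    then have "f y \<in> V" using Re_cnj_mult_arcpt[OF z0, of "Im (mz y)"] by (simp add: V_def pf)
    moreover have "g (f y) = y"
      using y k w0 by (intro mcgehee_eqI)
        (simp_all add: g_def pf slope_arcpt[OF z0] slope_of_real_mult slope_line model_space_3
          complex_eq_iff)
    ultimately show ?thesis by (simp add: crit_set_def inner_e pf)
  qed
  moreover have "g q \<in> U \<inter> ?S \<and> 0 \<le> g q \<bullet> (1, 0, 0, 0) \<and> f (g q) = q" if q:
    "q \<in> energy_level \<mu> c \<inter> V" for q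
  proof -
    let ?k = "(cmod w0)\<^sup>2 / Re (cnj w0 * momentum q)"
    have q': "0 < Re (cnj w0 * momentum q)" "0 < Re (cnj z0 * mz q)" "cmod (mz q) = 1" "0 \<le> mx q"
      "position q \<in> noncoll \<mu>" "hamiltonian \<mu> q = c"
      using q by (simp_all add: V_def energy_level_iff)
    have k: "0 < ?k" using q' w0 by simp
    have "momentum (h (g q)) = momentum (scale_momentum ?k q)"
      unfolding momentum_h momentum_scale_momentum using one_plus_slope[OF q'(1)]
        by (simp add: g_def)
    then have hg: "h (g q) = scale_momentum ?k q"
      by (intro mcgehee_eqI) (simp_all add: momentum_def, simp_all add: h_def g_def
        arcpt_slope[OF z0 q'(3,2)])
    have "h (g q) \<in> ray_domain \<mu>"
      unfolding hg scale_momentum_ray_domain[OF k] using energy_level_ray_domain[OF \<mu> c q'(5,6)] .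
    moreover have "f (g q) = q"
      unfolding f_def hg level_proj_scale_momentum[OF \<mu> c k]
        by (rule level_proj_energy_level[OF \<mu> c q'(6)])
    ultimately show ?thesis
      using q' by (simp add: U_def inner_e model_space_3) (simp add: g_def)
  qed
  moreover have "p \<in> V"
    using z0 Re_cnj_mult_self_pos[of z0] Re_cnj_mult_self_pos[OF w0]
    by (fastforce simp: V_def z0_def w0_def)
  ultimately show "\<exists>U V f g. open U \<and> open V \<and> p \<in> V \<and> Cinf_on U f \<and> Cinf_on V g \<and>
      (\<forall>y\<in>U \<inter> ?S. 0 \<le> y \<bullet> (1, 0, 0, 0) \<longrightarrow> f y \<in> energy_level \<mu> c \<inter> V \<and> g (f y) = y \<and>
        (f y \<in> crit_set (energy_level \<mu> c) mx \<longleftrightarrow> y \<bullet> (1, 0, 0, 0) = 0)) \<and>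
      (\<forall>q\<in>energy_level \<mu> c \<inter> V. g q \<in> U \<inter> ?S \<and> 0 \<le> g q \<bullet> (1, 0, 0, 0) \<and> f (g q) = q)"
    using U V f g by blast
qed (auto simp: subspace_model_space dim_model_space model_space_3 crit_set_def zero_prod_def)

section \<open>Frames of b-vector fields\<close>

text \<open>Smoothness of the partial derivatives in fixed directions extends to varying directions
  by expanding \<open>V\<close> in the basis.\<close>

lemma Cinf_on_derivative_along:
  fixes F :: "'a::euclidean_space \<Rightarrow> 'b::real_normed_vector"
  assumes U: "open U" and F: "Cinf_on U F" and V: "Cinf_on U V"
  shows "Cinf_on U (\<lambda>s. frechet_derivative F (at s) (V s))"
proof -
  have "Cinf_on U (\<lambda>s. \<Sum>b\<in>Basis. (V s \<bullet> b) *\<^sub>R frechet_derivative F (at s) b)"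
    unfolding Cinf_on_def
    using Cinf_on_frechet_derivative[OF F]
      Cinf_on_bounded_linear_compose[OF bounded_linear_inner_left U V]
    by (intro allI Ck_on_sum U finite_Basis Ck_on_bilinear[OF bounded_bilinear_scaleR])
      (simp_all add: Cinf_on_def)
  then show ?thesis
  proof (rule iffD1[OF Cinf_on_cong[OF U], rotated])
    fix s assume "s \<in> U"
    then have lin: "linear (frechet_derivative F (at s))"
      using Cinf_on_has_derivative[OF F] has_derivative_linear by blast
    show "(\<Sum>b\<in>Basis. (V s \<bullet> b) *\<^sub>R frechet_derivative F (at s) b)
        = frechet_derivative F (at s) (V s)"
      using linear_sum[OF lin, of "\<lambda>b. (V s \<bullet> b) *\<^sub>R b" Basis]
      by (simp add: euclidean_representation linear_cmul[OF lin])
  qed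
qed

definition e\<^sub>x :: mcgehee where "e\<^sub>x = (1, 0, 0, 0)"
definition e\<^sub>r :: mcgehee where "e\<^sub>r = (0, 0, 1, 0)"
definition e\<^sub>P :: mcgehee where "e\<^sub>P = (0, 0, 0, 1)"
definition e\<^sub>\<phi> :: "mcgehee \<Rightarrow> mcgehee" where "e\<^sub>\<phi> s = (0, \<i> * mz s, 0, 0)"

lemma frame_proj [simp]:
  "mx e\<^sub>x = 1" "mz e\<^sub>x = 0" "mPr e\<^sub>x = 0" "mP\<phi> e\<^sub>x = 0"
  "mx e\<^sub>r = 0" "mz e\<^sub>r = 0" "mPr e\<^sub>r = 1" "mP\<phi> e\<^sub>r = 0"
  "mx e\<^sub>P = 0" "mz e\<^sub>P = 0" "mPr e\<^sub>P = 0" "mP\<phi> e\<^sub>P = 1"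
  "mx (e\<^sub>\<phi> s) = 0" "mz (e\<^sub>\<phi> s) = \<i> * mz s" "mPr (e\<^sub>\<phi> s) = 0" "mP\<phi> (e\<^sub>\<phi> s) = 0"
  by (simp_all add: e\<^sub>x_def e\<^sub>r_def e\<^sub>P_def e\<^sub>\<phi>_def)

lemma frame_ang [simp]:
  "ang s e\<^sub>x = 0" "ang s e\<^sub>r = 0" "ang s e\<^sub>P = 0" "mz s \<noteq> 0 \<Longrightarrow> ang s (e\<^sub>\<phi> s) = 1"
  by (simp_all add: ang_def)

lemma inner_i_mult [simp]: "z \<bullet> (\<i> * z) = 0"
  by (simp add: inner_complex_def)

lemma Cinf_on_e\<phi>: "open U \<Longrightarrow> Cinf_on U e\<^sub>\<phi>"
  unfolding e\<^sub>\<phi>_def[abs_def] by (intro Cinf_intros Cinf_on_mcgehee_proj)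

lemma tangent_vector_expand:
  assumes "cmod (mz s) = 1" "mz s \<bullet> mz v = 0"
  shows "v = mx v *\<^sub>R e\<^sub>x + ang s v *\<^sub>R e\<^sub>\<phi> s + mPr v *\<^sub>R e\<^sub>r + mP\<phi> v *\<^sub>R e\<^sub>P"
  by (rule mcgehee_eqI) (simp_all add: ang_tangent[OF assms] scaleR_conv_of_real)

lemma bm_vector_fieldI:
  assumes "open U" "N \<subseteq> U" "Cinf_on U V" "Cinf_on U g"
    "\<And>s. s \<in> N \<Longrightarrow> V s \<in> tangent_space N s" "\<And>s. s \<in> N \<Longrightarrow> mx (V s) = mx s ^ m * g s"
  shows "bm_vector_field m N mx V"
  unfolding bm_vector_field_def
proof (intro conjI ballI exI[of _ g])
  show "smooth_on N V" "smooth_on N g"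
    using smooth_onI[OF assms(1,2)] assms(3,4) by blast+
qed (simp_all add: assms(5,6))

lemma bm_vector_field_phase_space:
  assumes "Cinf_on UNIV V" "Cinf_on UNIV g"
    "\<And>s. mz s \<bullet> mz (V s) = 0" "\<And>s. mx (V s) = mx s ^ m * g s"
  shows "bm_vector_field m (phase_space \<mu>) mx V"
  by (rule bm_vector_fieldI[OF open_UNIV _ assms(1,2)])
    (simp_all add: tangent_space_phase_space assms)

section \<open>The symplectic manifold\<close>

lemma mz_nonzero: "s \<in> phase_space \<mu> \<Longrightarrow> mz s \<noteq> 0"
  by (auto simp: phase_space_iff)

lemma bm_manifold_phase_space: "bm_manifold 4 (phase_space \<mu>) (crit_set (phase_space \<mu>) mx) mx"
  unfolding bm_manifold_def
proof (intro conjI ballI)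
  show "\<exists>U. open U \<and> phase_space \<mu> \<subseteq> U \<and> Cinf_on U mx"
    using Cinf_on_mcgehee_proj(1) open_UNIV by blast
  show "\<exists>v\<in>tangent_space (phase_space \<mu>) s. frechet_derivative mx (at s) v \<noteq> 0"
    if "s \<in> crit_set (phase_space \<mu>) mx" for s
    using that by (intro bexI[of _ e\<^sub>x]) (auto simp: crit_set_def tangent_space_phase_space)
qed (simp_all add: manifold_phase_space)

text \<open>The frame \<open>x\<^sup>3 \<partial>\<^sub>x, \<partial>\<^sub>r, \<partial>\<^sub>\<phi>, \<partial>\<^sub>P\<close> consists of \<open>b\<^sup>3\<close>-fields and pairs with \<open>\<omega> \<and> \<omega>\<close> to the
  constant \<open>2 \<cdot> (- 4) \<cdot> 1\<close>.\<close>

lemma bm_symplectic_phase_space: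
  "bm_symplectic 3 2 (phase_space \<mu>) (crit_set (phase_space \<mu>) mx) mx symp_form"
proof -
  let ?V = "\<lambda>i::nat. if i = 0 then (\<lambda>s. mx s ^ 3 *\<^sub>R e\<^sub>x) else if i = 1 then (\<lambda>s. e\<^sub>r)
    else if i = 2 then e\<^sub>\<phi> else (\<lambda>s. e\<^sub>P)"
  have "bm_vector_field 3 (phase_space \<mu>) mx (?V i)" for i
  proof -
    consider "i = 0" | "i = 1" | "i = 2" | "i > 2" by linarith
    then show ?thesis
    proof cases
      case 1
      then show ?thesis
        by (auto intro!: bm_vector_field_phase_space[where g = "\<lambda>s. 1"] Cinf_intros
          Cinf_on_mcgehee_proj)
    next
      case 2
      then show ?thesis
        by (auto intro!: bm_vector_field_phase_space[where g = "\<lambda>s. 0"])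
    next
      case 3
      then show ?thesis
        by (auto intro!: bm_vector_field_phase_space[where g = "\<lambda>s. 0"] Cinf_on_e\<phi>)
    next
      case 4
      then show ?thesis
        by (auto intro!: bm_vector_field_phase_space[where g = "\<lambda>s. 0"])
    qed
  qed
  moreover have "wedge_power symp_form 2 q (\<lambda>i. ?V i q) = - 8" if "q \<in> phase_space \<mu>" "mx q \<noteq> 0"
    for q
    unfolding symp_form_volume using that mz_nonzero[OF that(1)] by (simp add: symp_at_def)
  moreover have "smooth_on (phase_space \<mu>) (\<lambda>s. - 8 :: real)"
    by (rule smooth_onI[OF open_UNIV]) simp_all
  ultimately have "bm_nonvanishing 3 (phase_space \<mu>) mx 4 (wedge_power symp_form 2)"
    unfolding bm_nonvanishing_def
    by (intro ballI exI[of _ ?V] exI[of _ "\<lambda>s. - 8 :: real"]) simp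
  then show ?thesis
    unfolding bm_symplectic_def bm_closed_def
    using bm_manifold_phase_space bm_form_symp_form[of "phase_space \<mu>"] mz_nonzero[of _ \<mu>]
    by (simp add: crit_set_def ext_deriv_symp_form del: split_paired_All)
qed

lemma liouville_field_phase_space: "liouville_field (phase_space \<mu>) mx symp_form Y_field"
  unfolding liouville_field_def
proof (intro conjI ballI allI impI exI[of _ UNIV])
  show "Cinf_on UNIV Y_field" by (rule Cinf_on_bounded_linear[OF Y_field_bounded_linear open_UNIV])
  show "lie_deriv 2 Y_field symp_form s v = symp_form s v" if "s \<in> phase_space \<mu>
    - crit_set (phase_space \<mu>) mx" for s v
    using that mz_nonzero[of s \<mu>] by (intro lie_deriv_symp_form) (auto simp: crit_set_def)
qed (simp_all add: tangent_space_phase_space)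

lemma bm_vector_field_Y: "bm_vector_field 3 (phase_space \<mu>) mx Y_field"
  by (rule bm_vector_field_phase_space[where g = "\<lambda>s. 0"])
    (simp_all add: Cinf_on_bounded_linear[OF Y_field_bounded_linear])

section \<open>The contact energy levels\<close>

text \<open>The component of a field tangent to the energy levels. As \<open>Y\<close> has no \<open>x\<close>-component, the
  order of vanishing of \<open>dx\<close> is preserved.\<close>

definition proj_along_Y :: "real \<Rightarrow> (mcgehee \<Rightarrow> mcgehee) \<Rightarrow> mcgehee \<Rightarrow> mcgehee" where
  "proj_along_Y \<mu> V s = V s - (dH \<mu> s (V s) / YH s) *\<^sub>R Y_field s"

text \<open>The field \<open>- X / Y H\<close>, where \<open>X\<close> solves \<open>\<omega>(X, \<cdot>) = dH\<close>. The pole of \<open>\<omega>\<close> turns into the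
  factors \<open>x\<^sup>3\<close>, so the formula is smooth at \<open>x = 0\<close>.\<close>

definition reeb :: "real \<Rightarrow> mcgehee \<Rightarrow> mcgehee" where
  "reeb \<mu> s = (- 1 / YH s) *\<^sub>R
    ((- (mx s ^ 3 * mPr s / 4)) *\<^sub>R e\<^sub>x + dH \<mu> s e\<^sub>P *\<^sub>R e\<^sub>\<phi> s
     + (mx s ^ 3 / 4 * dH \<mu> s e\<^sub>x) *\<^sub>R e\<^sub>r - dH \<mu> s (e\<^sub>\<phi> s) *\<^sub>R e\<^sub>P)"

text \<open>An open set that contains all positive energy levels and on which division by \<open>Y H\<close> is
  smooth.\<close>

definition level_nbhd :: "real \<Rightarrow> mcgehee set" where
  "level_nbhd \<mu> = {s. position s \<in> noncoll \<mu>} \<inter> {s. 0 < YH s}"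

lemma Cinf_on_YH: "open U \<Longrightarrow> Cinf_on U YH"
  unfolding YH_def[abs_def] by (intro Cinf_intros Cinf_on_mcgehee_proj) auto

lemma open_level_nbhd: "open (level_nbhd \<mu>)"
proof -
  have "continuous_on UNIV YH" by (intro Cinf_on_imp_continuous_on Cinf_on_YH open_UNIV)
  then show ?thesis unfolding level_nbhd_def
    by (intro open_Int open_position_vimage open_Collect_less continuous_intros)
qed

lemma Cinf_on_dH:
  assumes "Cinf_on (level_nbhd \<mu>) V"
  shows "Cinf_on (level_nbhd \<mu>) (\<lambda>s. dH \<mu> s (V s))"
proof -
  have "Cinf_on (level_nbhd \<mu>) (hamiltonian \<mu>)"
    by (rule Cinf_on_subset[OF Cinf_on_hamiltonian open_level_nbhd open_position_vimage])
      (auto simp: level_nbhd_def)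
  from Cinf_on_derivative_along[OF open_level_nbhd this assms]
  show ?thesis
    by (rule iffD1[OF Cinf_on_cong[OF open_level_nbhd], rotated])
      (simp add: level_nbhd_def dH_eq_frechet_derivative)
qed

lemma Cinf_on_proj_along_Y:
  assumes "Cinf_on UNIV V"
  shows "Cinf_on (level_nbhd \<mu>) (proj_along_Y \<mu> V)"
proof -
  have "Cinf_on (level_nbhd \<mu>) V"
    by (rule Cinf_on_subset[OF assms open_level_nbhd]) simp_all
  then show ?thesis
    unfolding proj_along_Y_def[abs_def]
    by (intro Cinf_intros Cinf_on_dH Cinf_on_YH open_level_nbhd
        Cinf_on_bounded_linear[OF Y_field_bounded_linear])
      (auto simp: level_nbhd_def)
qed

lemma Cinf_on_reeb: "Cinf_on (level_nbhd \<mu>) (reeb \<mu>)"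
  unfolding reeb_def[abs_def]
  by (intro Cinf_intros Cinf_on_mcgehee_proj Cinf_on_dH Cinf_on_YH open_level_nbhd Cinf_on_e\<phi>)
    (auto simp: level_nbhd_def)

lemma dH_tangent_expand:
  assumes "cmod (mz s) = 1" "mz s \<bullet> mz v = 0" "position s \<in> noncoll \<mu>"
  shows "dH \<mu> s v = mx v * dH \<mu> s e\<^sub>x + ang s v * dH \<mu> s (e\<^sub>\<phi> s) + mPr v * mPr s + mP\<phi> v * dH \<mu> s e\<^sub>P"
proof -
  have "dpot \<mu> (position s) 0 = 0"
    using pot_has_derivative[OF assms(3)] has_derivative_linear linear_0 by blast
  then have "dH \<mu> s e\<^sub>r = mPr s" by (simp add: dH_def zero_prod_def)
  then show ?thesis
    by (subst tangent_vector_expand[OF assms(1,2)]) (simp add: dH_linear_simps[OF assms(3)])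
qed

lemma dH_eP:
  assumes "position s \<in> noncoll \<mu>"
  shows "dH \<mu> s e\<^sub>P = mx s ^ 4 * mP\<phi> s / 4 - 1"
proof -
  have "dpot \<mu> (position s) 0 = 0"
    using pot_has_derivative[OF assms(1)] has_derivative_linear linear_0 by blast
  then show ?thesis by (simp add: dH_def zero_prod_def)
qed

lemma contract_ext_deriv:
  assumes "mx s \<noteq> 0" "mz s \<noteq> 0"
  shows "contract R (ext_deriv 1 (contract Y_field symp_form)) s v = symp_at s (R s) (v 0)"
  unfolding contract_def[of R] ext_deriv_contract_Y_symp_form[OF assms] by simp

text \<open>As \<open>\<omega>(Y, \<cdot>) = \<lambda>\<close> and \<open>\<lambda>(Y) = 0\<close>, a projection along \<open>Y\<close> changes the summands of \<open>\<lambda> \<and> d\<lambda>\<close>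
  by multiples of \<open>\<lambda>\<close>, which cancel in the alternating sum.\<close>

lemma symp_at_minus_Y_field:
  "symp_at s (u - a *\<^sub>R Y_field s) (v - b *\<^sub>R Y_field s) = symp_at s u v - a * liou_at s v
    + b * liou_at s u"
  by (simp add: symp_at_def liou_at_def algebra_simps add_divide_distrib diff_divide_distrib)

lemma liou_at_diff: "liou_at s (u - v) = liou_at s u - liou_at s v"
  by (simp add: liou_at_def right_diff_distrib)

lemma symp_at_diff_left: "symp_at s (u - v) w = symp_at s u w - symp_at s v w"
  by (simp add: symp_at_def algebra_simps add_divide_distrib diff_divide_distrib)

lemma liou_at_minus_Y_field: "liou_at s (u - a *\<^sub>R Y_field s) = liou_at s u"
  by (simp add: liou_at_def)

context
  fixes \<mu> c :: real
  assumes \<mu>: "0 < \<mu>" "\<mu> < 1" and c: "0 < c"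
begin

lemma energy_level_facts:
  assumes "s \<in> energy_level \<mu> c"
  shows "0 \<le> mx s" "cmod (mz s) = 1" "mz s \<noteq> 0" "position s \<in> noncoll \<mu>" "hamiltonian \<mu> s = c"
    "0 < YH s"
    "s \<in> level_nbhd \<mu>"
  using assms YH_pos[OF \<mu>, of s] c by (auto simp: energy_level_iff level_nbhd_def)

lemma bm_vector_field_proj_along_Y:
  assumes "Cinf_on UNIV V" "Cinf_on UNIV g"
    "\<And>s. mz s \<bullet> mz (V s) = 0" "\<And>s. mx (V s) = mx s ^ 3 * g s"
  shows "bm_vector_field 3 (energy_level \<mu> c) mx (proj_along_Y \<mu> V)"
proof (rule bm_vector_fieldI[OF open_level_nbhd _ Cinf_on_proj_along_Y[OF assms(1)]])
  show "Cinf_on (level_nbhd \<mu>) g" by (rule Cinf_on_subset[OF assms(2) open_level_nbhd]) simp_all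
  fix s assume s: "s \<in> energy_level \<mu> c"
  note f = energy_level_facts[OF s]
  show "proj_along_Y \<mu> V s \<in> tangent_space (energy_level \<mu> c) s"
    using f(6) by (simp add: tangent_space_energy_level[OF \<mu> c s] proj_along_Y_def assms(3)
        dH_linear_simps[OF f(4)] dH_Y_field[OF f(4)])
  show "mx (proj_along_Y \<mu> V s) = mx s ^ 3 * g s"
    by (simp add: proj_along_Y_def assms(4))
qed (rule subsetI, rule energy_level_facts(7))

lemma bm_manifold_energy_level: "bm_manifold 3 (energy_level \<mu> c) (crit_set (energy_level \<mu> c) mx)
  mx"
  unfolding bm_manifold_def
proof (intro conjI ballI)
  show "\<exists>U. open U \<and> energy_level \<mu> c \<subseteq> U \<and> Cinf_on U mx"
    using Cinf_on_mcgehee_proj(1) open_UNIV by blast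
  fix s assume "s \<in> crit_set (energy_level \<mu> c) mx"
  then have s: "s \<in> energy_level \<mu> c" "mx s = 0" by (auto simp: crit_set_def)
  have "dH \<mu> s e\<^sub>x = 0"
    using s(2) dpot_at_infinity energy_level_facts(3)[OF s(1)] by (simp add: dH_def)
  then show "\<exists>v\<in>tangent_space (energy_level \<mu> c) s. frechet_derivative mx (at s) v \<noteq> 0"
    by (intro bexI[of _ e\<^sub>x]) (simp_all add: tangent_space_energy_level[OF \<mu> c s(1)])
qed (simp_all add: manifold_energy_level[OF \<mu> c])

text \<open>The third field of the frame rotates the momentum. The projections of \<open>\<partial>\<^sub>r\<close> or \<open>\<partial>\<^sub>P\<close> alone
  would not do, because they give multiples of \<open>P\<^sub>\<phi>\<close> and \<open>P\<^sub>r\<close>, which may vanish.\<close>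

lemma bm_contact_energy_level:
  "bm_contact 3 1 (energy_level \<mu> c) (crit_set (energy_level \<mu> c) mx) mx
    (contract Y_field symp_form)"
proof -
  define W :: "nat \<Rightarrow> mcgehee \<Rightarrow> mcgehee" where
    "W i = (if i = 0 then (\<lambda>s. mx s ^ 3 *\<^sub>R e\<^sub>x) else if i = 1 then e\<^sub>\<phi>
      else (\<lambda>s. mP\<phi> s *\<^sub>R e\<^sub>r - mPr s *\<^sub>R e\<^sub>P))" for i
  let ?V = "\<lambda>i. proj_along_Y \<mu> (W i)"
  let ?g = "\<lambda>s. - 4 * ((mPr s)\<^sup>2 + (mP\<phi> s)\<^sup>2)"
  have V: "bm_vector_field 3 (energy_level \<mu> c) mx (?V i)" for i
  proof -
    consider "i = 0" | "i = 1" | "i > 1" by linarith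
    then show ?thesis
    proof cases
      case 1
      then show ?thesis
        by (auto simp: W_def intro!: bm_vector_field_proj_along_Y[where g = "\<lambda>s. 1"] Cinf_intros
          Cinf_on_mcgehee_proj)
    next
      case 2
      then show ?thesis
        by (auto simp: W_def intro!: bm_vector_field_proj_along_Y[where g = "\<lambda>s. 0"] Cinf_on_e\<phi>)
    next
      case 3
      then show ?thesis
        by (auto simp: W_def intro!: bm_vector_field_proj_along_Y[where g = "\<lambda>s. 0"] Cinf_intros
          Cinf_on_mcgehee_proj)
    qed
  qed
  have vol: "wedge 1 2 (contract Y_field symp_form)
    (wedge_power (ext_deriv 1 (contract Y_field symp_form)) 1)
      q (\<lambda>i. ?V i q) = ?g q" if q: "q \<in> energy_level \<mu> c" "mx q \<noteq> 0" for q
  proof -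
    let ?a = "\<lambda>i. dH \<mu> q (W i q) / YH q"
    have l: "liou_at q (?V i q) = liou_at q (W i q)" for i
      unfolding proj_along_Y_def by (rule liou_at_minus_Y_field)
    have s: "symp_at q (?V i q) (?V j q)
        = symp_at q (W i q) (W j q) - ?a i * liou_at q (W j q) + ?a j * liou_at q (W i q)" for i j
      unfolding proj_along_Y_def by (rule symp_at_minus_Y_field)
    have "wedge 1 2 (contract Y_field symp_form)
      (wedge_power (ext_deriv 1 (contract Y_field symp_form)) 1)
        q (\<lambda>i. ?V i q) = liou_at q (W 0 q) * symp_at q (W 1 q) (W 2 q)
          - liou_at q (W 1 q) * symp_at q (W 0 q) (W 2 q)
          + liou_at q (W 2 q) * symp_at q (W 0 q) (W 1 q)"
      unfolding contact_volume[OF q(2) energy_level_facts(3)[OF q(1)]] l s by algebra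
    also have "\<dots> = ?g q"
      using q energy_level_facts(3)[OF q(1)]
      by (simp add: W_def liou_at_def symp_at_def power2_eq_square algebra_simps)
    finally show ?thesis .
  qed
  have "?g s \<noteq> 0" if "s \<in> energy_level \<mu> c" for s
  proof -
    have "mPr s \<noteq> 0 \<or> mP\<phi> s \<noteq> 0"
      using energy_level_facts(6)[OF that] by (auto simp: YH_def)
    then have "0 < (mPr s)\<^sup>2 + (mP\<phi> s)\<^sup>2" by (simp only: sum_power2_gt_zero_iff)
    then have "?g s < 0" by (simp only: mult_less_0_iff) simp
    then show ?thesis by (rule less_imp_neq)
  qed
  moreover have "smooth_on (energy_level \<mu> c) ?g"
    by (rule smooth_onI[OF open_UNIV]) (intro subset_UNIV Cinf_intros Cinf_on_mcgehee_proj
      open_UNIV)+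
  ultimately have "bm_nonvanishing 3 (energy_level \<mu> c) mx 3
      (wedge 1 2 (contract Y_field symp_form)
        (wedge_power (ext_deriv 1 (contract Y_field symp_form)) 1))"
    unfolding bm_nonvanishing_def using V vol
    by (intro ballI exI[of _ ?V] exI[of _ ?g] conjI) simp_all
  then show ?thesis
    unfolding bm_contact_def
    using bm_manifold_energy_level bm_form_contract_Y_symp_form energy_level_facts(3)
    by (simp add: numeral_3_eq_3)
qed

section \<open>The Reeb field\<close>

text \<open>As \<open>dH(X) = \<omega>(X, X) = 0\<close>.\<close>

lemma reeb_tangent:
  assumes s: "s \<in> energy_level \<mu> c"
  shows "mz s \<bullet> mz (reeb \<mu> s) = 0" "dH \<mu> s (reeb \<mu> s) = 0"
proof -
  note f = energy_level_facts[OF s]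
  show 1: "mz s \<bullet> mz (reeb \<mu> s) = 0" by (simp add: reeb_def)
  show "dH \<mu> s (reeb \<mu> s) = 0"
    unfolding dH_tangent_expand[OF f(2) 1 f(4)] using f(3) by (simp add: reeb_def)
qed

lemma reeb_field_reeb: "reeb_field 3 (energy_level \<mu> c) mx (contract Y_field symp_form) (reeb \<mu>)"
  unfolding reeb_field_def
proof (intro conjI ballI allI impI)
  show "bm_vector_field 3 (energy_level \<mu> c) mx (reeb \<mu>)"
  proof (rule bm_vector_fieldI[OF open_level_nbhd _ Cinf_on_reeb])
    show "Cinf_on (level_nbhd \<mu>) (\<lambda>s. mPr s / (4 * YH s))"
      by (intro Cinf_intros Cinf_on_mcgehee_proj Cinf_on_YH open_level_nbhd)
        (auto simp: level_nbhd_def)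
    show "reeb \<mu> s \<in> tangent_space (energy_level \<mu> c) s" if "s \<in> energy_level \<mu> c" for s
      using reeb_tangent[OF that] by (simp add: tangent_space_energy_level[OF \<mu> c that])
    show "mx (reeb \<mu> s) = mx s ^ 3 * (mPr s / (4 * YH s))" for s by (simp add: reeb_def)
  qed (rule subsetI, rule energy_level_facts(7))
  fix s assume "s \<in> energy_level \<mu> c - crit_set (energy_level \<mu> c) mx"
  then have s: "s \<in> energy_level \<mu> c" and x: "mx s \<noteq> 0" by (auto simp: crit_set_def)
  note f = energy_level_facts[OF s]
  have "mx (reeb \<mu> s) = mx s ^ 3 * mPr s / (4 * YH s)" "ang s (reeb \<mu> s) = - dH \<mu> s e\<^sub>P / YH s"
    using f(3) by (simp_all add: reeb_def)
  then have "liou_at s (reeb \<mu> s) = ((mPr s)\<^sup>2 + mP\<phi> s * dH \<mu> s e\<^sub>P) / YH s"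
    using x by (simp add: liou_at_def power2_eq_square add_divide_distrib)
  also have "(mPr s)\<^sup>2 + mP\<phi> s * dH \<mu> s e\<^sub>P = YH s"
    by (simp add: dH_eP[OF f(4)] YH_def power2_eq_square algebra_simps)
  finally have "liou_at s (reeb \<mu> s) = 1" using f(6) by simp
  then show "contract Y_field symp_form s (\<lambda>_. reeb \<mu> s) = 1"
    by (simp add: contract_Y_symp_form)
  fix v :: "nat \<Rightarrow> mcgehee" assume "v 0 \<in> tangent_space (energy_level \<mu> c) s"
  then have v: "mz s \<bullet> mz (v 0) = 0" "dH \<mu> s (v 0) = 0"
    by (auto simp: tangent_space_energy_level[OF \<mu> c s])
  have "symp_at s (reeb \<mu> s) (v 0) = (- 1 / YH s) * dH \<mu> s (v 0)"
    unfolding dH_tangent_expand[OF f(2) v(1) f(4)] using f(3) x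
    by (simp add: symp_at_def reeb_def) (simp add: field_simps add_divide_distrib)
  then show "contract (reeb \<mu>) (ext_deriv 1 (contract Y_field symp_form)) s v = 0"
    unfolding contract_ext_deriv[OF x f(3)] using v by simp
qed

text \<open>The difference \<open>D\<close> of two Reeb fields is \<open>\<omega>\<close>-orthogonal to the tangent space of the
  level. It is orthogonal to \<open>Y\<close> as well, since \<open>\<omega>(Y, D) = \<lambda>(D) = 0\<close>, hence to the tangent space
  of the phase space, and \<open>\<omega>\<close> is nondegenerate there.\<close>

lemma reeb_field_unique:
  assumes R: "reeb_field 3 (energy_level \<mu> c) mx (contract Y_field symp_form) R"
    and s: "s \<in> energy_level \<mu> c" and x: "mx s \<noteq> 0"
  shows "R s = reeb \<mu> s"
proof -
  note f = energy_level_facts[OF s]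
  have T: "tangent_space (energy_level \<mu> c) s = {v. mz s \<bullet> mz v = 0 \<and> dH \<mu> s v = 0}"
    by (rule tangent_space_energy_level[OF \<mu> c s])
  have props: "mz s \<bullet> mz (Q s) = 0 \<and> dH \<mu> s (Q s) = 0 \<and> liou_at s (Q s) = 1"
    if "reeb_field 3 (energy_level \<mu> c) mx (contract Y_field symp_form) Q" for Q
    using that s x unfolding reeb_field_def bm_vector_field_def
    by (auto simp: T crit_set_def contract_Y_symp_form)
  have orth: "symp_at s (Q s) v = 0"
    if "reeb_field 3 (energy_level \<mu> c) mx (contract Y_field symp_form) Q"
      "mz s \<bullet> mz v = 0" "dH \<mu> s v = 0" for Q v
  proof -
    have "contract Q (ext_deriv 1 (contract Y_field symp_form)) s (\<lambda>_. v) = 0"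
      using that s x unfolding reeb_field_def by (auto simp: T crit_set_def)
    then show ?thesis unfolding contract_ext_deriv[OF x f(3)] .
  qed
  define D where "D = R s - reeb \<mu> s"
  have D: "mz s \<bullet> mz D = 0" "dH \<mu> s D = 0" "liou_at s D = 0"
    using props[OF R] props[OF reeb_field_reeb]
    by (simp_all add: D_def inner_diff_right dH_linear_simps[OF f(4)] liou_at_diff)
  have symp_at_D: "symp_at s D v = 0" if "mz s \<bullet> mz v = 0" "dH \<mu> s v = 0" for v
    using orth[OF R that] orth[OF reeb_field_reeb that] by (simp add: D_def symp_at_diff_left)
  (* Adding the direction Y to the tangent space of the level fills that of the phase space. *)
  have W: "symp_at s D w = 0" if "mz s \<bullet> mz w = 0" for w
  proof -
    let ?k = "dH \<mu> s w / YH s"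
    have "symp_at s D (w - ?k *\<^sub>R Y_field s) = 0"
      by (rule symp_at_D) (use that f(6) in \<open>simp_all add: dH_linear_simps[OF f(4)]
        dH_Y_field[OF f(4)]\<close>)
    moreover have "symp_at s D (w - ?k *\<^sub>R Y_field s) = symp_at s D w + ?k * liou_at s D"
      using symp_at_minus_Y_field[of s D 0 w ?k] by simp
    ultimately show ?thesis using D by simp
  qed
  have "mPr D = 0" using W[of e\<^sub>x] x by (simp add: symp_at_def)
  moreover have "mx D = 0" using W[of e\<^sub>r] x by (simp add: symp_at_def)
  moreover have "ang s D = 0" using W[of e\<^sub>P] by (simp add: symp_at_def)
  moreover have "mP\<phi> D = 0" using W[of "e\<^sub>\<phi> s"] f(3) by (simp add: symp_at_def)
  ultimately have "D = 0"
    using tangent_vector_expand[OF f(2) D(1)] by simp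
  then show ?thesis by (simp add: D_def)
qed

text \<open>The defining identities of a Reeb field are imposed off \<open>x = 0\<close> only. A point at
  infinity is approached by projecting the curve with velocity \<open>\<partial>\<^sub>x\<close> to the level.\<close>

lemma reeb_field_at_infinity:
  assumes R: "reeb_field 3 (energy_level \<mu> c) mx (contract Y_field symp_form) R"
    and s: "s \<in> energy_level \<mu> c" and x: "mx s = 0"
  shows "R s = (1 / YH s) *\<^sub>R e\<^sub>\<phi> s"
proof -
  note f = energy_level_facts[OF s]
  let ?\<delta> = "\<lambda>t. level_proj \<mu> c (test_curve s e\<^sub>x t)"
  have W: "s \<in> phase_space \<mu>" and ray_domain: "s \<in> ray_domain \<mu>"
    using s f energy_level_ray_domain[OF \<mu> c] by (auto simp: energy_level_def)
  have "isCont (level_proj \<mu> c) (test_curve s e\<^sub>x 0)"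
    using Cinf_on_has_derivative[OF Cinf_on_level_proj[OF \<mu> c] ray_domain] has_derivative_continuous
      by force
  moreover have "isCont (test_curve s e\<^sub>x) 0"
    using test_curve_has_vector_derivative[of s e\<^sub>x] f(2) has_vector_derivative_continuous
      by fastforce
  ultimately have "isCont ?\<delta> 0" using isCont_o2 by blast
  then have lim: "(?\<delta> \<longlongrightarrow> s) (at_right 0)"
    unfolding isCont_def using level_proj_energy_level[OF \<mu> c f(5)] filterlim_at_split by fastforce
  have "\<forall>\<^sub>F t in at_right 0. test_curve s e\<^sub>x t \<in> phase_space \<mu>"
    "\<forall>\<^sub>F t in at_right 0. test_curve s e\<^sub>x t \<in> ray_domain \<mu>"
    using test_curve_phase_space[OF W, of e\<^sub>x]
      test_curve_tendsto[of s e\<^sub>x, OF f(2) _ open_ray_domain ray_domain] by auto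
  then have ev: "\<forall>\<^sub>F t in at_right 0. ?\<delta> t \<in> energy_level \<mu> c"
    by eventually_elim (auto simp: energy_level_iff phase_space_iff hamiltonian_level_proj[OF \<mu> c],
        simp_all add: level_proj_def)
  have "\<forall>\<^sub>F t in at_right (0::real). 0 < t" by (rule eventually_at_right_less)
  with ev have same: "\<forall>\<^sub>F t in at_right 0. R (?\<delta> t) = reeb \<mu> (?\<delta> t)"
    by eventually_elim (rule reeb_field_unique[OF R], simp_all add: level_proj_def test_curve_def x)
  have lims: "((\<lambda>t. Q (?\<delta> t)) \<longlongrightarrow> Q s) (at_right 0)"
    if "reeb_field 3 (energy_level \<mu> c) mx (contract Y_field symp_form) Q" for Q
    using that s ev lim smooth_on_imp_continuous_on[of "energy_level \<mu> c" Q]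
    by (intro continuous_on_tendsto_compose[of "energy_level \<mu> c" Q])
      (auto simp: reeb_field_def bm_vector_field_def)
  have "((\<lambda>t. reeb \<mu> (?\<delta> t)) \<longlongrightarrow> R s) (at_right 0)"
    using lims[OF R] tendsto_cong[OF same] by blast
  then have "R s = reeb \<mu> s"
    using lims[OF reeb_field_reeb] tendsto_unique trivial_limit_at_right_real by blast
  also have "dH \<mu> s (e\<^sub>\<phi> s) = 0"
    using x f(3) by (simp add: dH_def dpot_at_infinity)
  then have "reeb \<mu> s = (1 / YH s) *\<^sub>R e\<^sub>\<phi> s"
    by (simp add: reeb_def x dH_eP[OF f(4)])
  finally show ?thesis .
qed

lemma crit_set_energy_level:
  "s \<in> crit_set (energy_level \<mu> c) mx \<longleftrightarrow> mx s = 0 \<and> cmod (mz s) = 1 \<and> mP\<phi> s = (mPr s)\<^sup>2 / 2 - c"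
  by (auto simp: crit_set_def energy_level_iff noncoll_def hamiltonian_eq pot_def)

lemma crit_set_cylinder:
  "crit_set (energy_level \<mu> c) mx homeomorphic (sphere (0::complex) 1 \<times> (UNIV :: real set))"
  unfolding homeomorphic_def homeomorphism_def
proof (rule exI[of _ "\<lambda>s. (mz s, mPr s)"], rule exI[of _ "\<lambda>(z, r). (0, z, r, r\<^sup>2 / 2 - c)"],
    intro conjI ballI)
  let ?Z = "crit_set (energy_level \<mu> c) mx" and ?C = "sphere (0::complex) 1 \<times> (UNIV :: real set)"
  let ?f = "\<lambda>s. (mz s, mPr s)" and ?g = "\<lambda>(z, r). (0, z, r, r\<^sup>2 / 2 - c) :: mcgehee"
  show fg: "?f (?g y) = y" if "y \<in> ?C" for y by (simp split: prod.split)
  show gf: "?g (?f s) = s" if "s \<in> ?Z" for s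
    using that by (intro mcgehee_eqI) (simp_all add: crit_set_energy_level)
  have f: "?f s \<in> ?C" if "s \<in> ?Z" for s using that by (simp add: crit_set_energy_level)
  have g: "?g y \<in> ?Z" if "y \<in> ?C" for y using that by (auto simp: crit_set_energy_level)
  show "?f ` ?Z = ?C"
  proof (rule equalityI; rule subsetI)
    show "y \<in> ?f ` ?Z" if "y \<in> ?C" for y
      using imageI[OF g[OF that], of ?f] unfolding fg[OF that] .
  qed (erule imageE, simp only: f)
  show "?g ` ?C = ?Z"
  proof (rule equalityI; rule subsetI)
    show "s \<in> ?g ` ?C" if "s \<in> ?Z" for s
      using imageI[OF f[OF that], of ?g] unfolding gf[OF that] .
  qed (erule imageE, simp only: g)
  show "continuous_on ?Z ?f" by (intro continuous_intros)
  show "continuous_on ?C ?g" unfolding case_prod_unfold by (intro continuous_intros) auto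
qed

text \<open>On the circle with \<open>P\<^sub>r = r\<close> the speed of the angle is \<open>1 / Y H\<close> with \<open>Y H = r\<^sup>2 / 2 + c\<close>,
  constant along the circle.\<close>

lemma infinite_periodic_orbits:
  assumes R: "reeb_field 3 (energy_level \<mu> c) mx (contract Y_field symp_form) R"
  shows "infinite {C. C \<subseteq> crit_set (energy_level \<mu> c) mx \<and> nontrivial_periodic_orbit R C}"
proof -
  define K where "K r = r\<^sup>2 / 2 + c" for r :: real
  have K: "0 < K r" for r using c by (simp add: K_def add_nonneg_pos)
  define \<gamma> :: "real \<Rightarrow> real \<Rightarrow> mcgehee" where "\<gamma> r t = (0, cis (t / K r), r, r\<^sup>2 / 2 - c)" for r t
  have Z: "\<gamma> r t \<in> crit_set (energy_level \<mu> c) mx" for r t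
    by (simp add: crit_set_energy_level \<gamma>_def)
  have "nontrivial_periodic_orbit R (range (\<gamma> r))" for r
    unfolding nontrivial_periodic_orbit_def
  proof (intro exI conjI allI)
    fix t :: real
    have "R (\<gamma> r t) = (1 / YH (\<gamma> r t)) *\<^sub>R e\<^sub>\<phi> (\<gamma> r t)"
      using Z[of r t] by (intro reeb_field_at_infinity[OF R]) (auto simp: crit_set_def)
    then have eq: "R (\<gamma> r t) = (0, (1 / K r) *\<^sub>R (\<i> * cis (t / K r)), 0, 0)"
      by (simp add: \<gamma>_def YH_def K_def e\<^sub>\<phi>_def)
    have "((\<lambda>t. t / K r) has_derivative (\<lambda>h. h / K r)) (at t)"
      by (rule bounded_linear.has_derivative[OF bounded_linear_divide has_derivative_ident])
    from has_derivative_cis[OF this]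
    have "(\<gamma> r has_derivative (\<lambda>h. (0, (h / K r) *\<^sub>R (\<i> * cis (t / K r)), 0, 0))) (at t)"
      unfolding \<gamma>_def by (intro has_derivative_Pair has_derivative_const)
    then show "(\<gamma> r has_vector_derivative R (\<gamma> r t)) (at t)"
      unfolding eq has_vector_derivative_def by simp
    show "\<gamma> r (t + 2 * pi * K r) = \<gamma> r t"
      using K[of r] by (simp add: \<gamma>_def add_divide_distrib flip: cis_mult)
  next
    show "0 < 2 * pi * K r" using K[of r] by simp
    show "\<gamma> r (pi * K r) \<noteq> \<gamma> r 0"
      using K[of r] by (simp add: \<gamma>_def complex_eq_iff)
  qed simp
  then have "range (\<lambda>r. range (\<gamma> r)) \<subseteq> {C. C \<subseteq> crit_set (energy_level \<mu> c) mx
    \<and> nontrivial_periodic_orbit R C}"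
    using Z by auto
  moreover have "inj (\<lambda>r. range (\<gamma> r))"
  proof (rule injI)
    fix r r' assume "range (\<gamma> r) = range (\<gamma> r')"
    then obtain t where "\<gamma> r 0 = \<gamma> r' t" by (metis rangeE rangeI)
    then show "r = r'" by (simp add: \<gamma>_def)
  qed
  then have "infinite (range (\<lambda>r. range (\<gamma> r)))"
    using finite_imageD infinite_UNIV_char_0 by blast
  ultimately show ?thesis using infinite_super by blast
qed

end

theorem theorem4p4:
  fixes \<mu> :: real
  assumes "0 < \<mu>" and "\<mu> < 1"
  shows "bm_symplectic 3 2 (phase_space \<mu>) (crit_set (phase_space \<mu>) mx) mx symp_form \<and>
    liouville_field (phase_space \<mu>) mx symp_form Y_field \<and>
    bm_vector_field 3 (phase_space \<mu>) mx Y_field \<and>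
    (\<forall>c>0. transverse_to (phase_space \<mu>) (energy_level \<mu> c) Y_field) \<and>
    (\<forall>c>0. bm_contact 3 1 (energy_level \<mu> c) (crit_set (energy_level \<mu> c) mx) mx
       (contract Y_field symp_form)) \<and>
    (\<forall>c>0. crit_set (energy_level \<mu> c) mx homeomorphic
       (sphere (0::complex) 1 \<times> (UNIV :: real set))) \<and>
    (\<forall>c>0. (\<exists>R. reeb_field 3 (energy_level \<mu> c) mx (contract Y_field symp_form) R) \<and>
       (\<forall>R. reeb_field 3 (energy_level \<mu> c) mx (contract Y_field symp_form) R \<longrightarrow>
          infinite {C. C \<subseteq> crit_set (energy_level \<mu> c) mx \<and> nontrivial_periodic_orbit R C}))"
  using bm_symplectic_phase_space liouville_field_phase_space bm_vector_field_Y
    transverse_energy_level[OF assms] bm_contact_energy_level[OF assms] crit_set_cylinder[OF assms]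
    reeb_field_reeb[OF assms] infinite_periodic_orbits[OF assms]
  by blast

end
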